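(* Let $\mathcal{M}=\mathcal{M}(\Sigma,I)$ be a trace monoid, $X$ a finite nonempty set, and $X\times\mathcal{M}\to X$, $(\alpha,x)\mapsto\alpha\cdot x$, a right action. Let $F=(f_\alpha)_{\alpha\in X}$ be a Möbius fibred valuation. Then there exists a unique Markov measure $\mathbb{P}=(\mathbb{P}_\alpha)_{\alpha\in X}$ such that $f_\alpha(x)=\mathbb{P}_\alpha(\uparrow x)$ for all $\alpha\in X$ and $x\in\mathcal{M}$. Moreover, let $h_\alpha$ be the Möbius transform of $f_\alpha|_{\mathscr{C}}$, $g_{\alpha}(\gamma)=\sum_{\gamma'\in\mathfrak{C}:\gamma\to\gamma'}h_{\alpha}(\gamma')$, and $P$ the matrix on $X\times\mathfrak{C}$ given by $P_{(\alpha,\gamma),(\alpha',\gamma')}=\mathbf{1}_{\{\alpha'=\alpha\cdot\gamma\}}\mathbf{1}_{\{\gamma\to\gamma'\}}h_{\alpha'}(\gamma')/g_{\alpha'}(\gamma)$ (and $0$ when $g_{\alpha'}(\gamma)=0$). For each $\alpha\in X$, let $(X_{i-1},C_i)_{i\geq1}$ be a Markov chain with transition matrix $P$ and initial law $\delta_{\{\alpha\}}\otimes(h_\alpha|_{\mathfrak{C}})$ on a probability space $(\Omega,\mathcal{G},\mathbb{Q}_\alpha)$. Then $\mathbb{P}_\alpha$ is the law under $\mathbb{Q}_\alpha$ of the random element $\xi=(C_i)_{i\geq1}$ of $\partial\mathcal{M}$ (i.e. $\xi=\bigvee_{n\geq1}C_1\cdot\ldots\cdot C_n$).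
   Context: $\mathcal{M}(\Sigma,I)$: $\Sigma$ finite alphabet, $|\Sigma|\ge2$, $I$ irreflexive symmetric; $\mathcal{M}$ is $\Sigma^*$ modulo the congruence generated by $ab=ba$, $(a,b)\in I$; unit $1$, length $|x|$, $x\leq y$ iff $y=x\cdot z$ for some $z$. Cliques: traces $a_1\cdots a_k$ with pairwise distinct letters, pairwise in $I$; $\mathscr{C}$ the cliques, $\mathfrak{C}=\mathscr{C}\setminus\{1\}$, ordered by inclusion. $c\to c'$ for cliques means every $b\in c'$ has some $a\in c$ with $(a,b)\notin I$. Each nonempty trace is uniquely $c_1\cdots c_n$ with $c_i\in\mathfrak{C}$, $c_i\to c_{i+1}$; $\tau(x)=n$, $\tau(1)=0$. $\partial\mathcal{M}$ is the set of infinite sequences $(c_i)_{i\ge1}$ of nonempty cliques with $c_i\to c_{i+1}$; $x\leq(c_i)$ iff $x\leq c_1\cdots c_{\tau(x)}$; $\uparrow x=\{\xi\in\partial\mathcal{M}:x\le\xi\}$; $\partial\mathcal{M}$ has the $\sigma$-algebra generated by these sets. Möbius transform of $f:\mathscr{C}\to\mathbb{R}$: $h(c)=\sum_{c'\ge c}(-1)^{|c'|-|c|}f(c')$. A fibred valuation is a family $(f_\alpha)_{\alpha\in X}$, $f_\alpha:\mathcal{M}\to\mathbb{R}$, with $f_\alpha(1)=1$ and $f_\alpha(x\cdot y)=f_\alpha(x)f_{\alpha\cdot x}(y)$; it is Möbius if $h_\alpha(1)=0$ and $h_\alpha(\gamma)\ge0$ for all $\gamma\in\mathfrak{C}$, $\alpha\in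 X$. A Markov measure is a family $(\mathbb{P}_\alpha)_{\alpha\in X}$ of probability measures on $\partial\mathcal{M}$ with $\mathbb{P}_\alpha(\uparrow(x\cdot y))=\mathbb{P}_\alpha(\uparrow x)\mathbb{P}_{\alpha\cdot x}(\uparrow y)$ for all $\alpha,x,y$. *)

theory Defs
  imports "HOL-Probability.Probability" "HOL-Algebra.Divisibility"
begin

section \<open>Trace monoids\<close>

text \<open>
  The alphabet is a type \<open>'a\<close> of class \<open>finite\<close>; a trace is an equivalence class of words.
\<close>

type_synonym 'a trace = "'a list set"

inductive trace_cong :: "('a \<times> 'a) set \<Rightarrow> 'a list \<Rightarrow> 'a list \<Rightarrow> bool" for I where
  swap: "(a, b) \<in> I \<Longrightarrow> trace_cong I [a, b] [b, a]"
| refl: "trace_cong I u u"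
| sym: "trace_cong I u v \<Longrightarrow> trace_cong I v u"
| trans: "trace_cong I u v \<Longrightarrow> trace_cong I v w \<Longrightarrow> trace_cong I u w"
| append: "trace_cong I u v \<Longrightarrow> trace_cong I u' v' \<Longrightarrow> trace_cong I (u @ u') (v @ v')"

definition trace_of :: "('a \<times> 'a) set \<Rightarrow> 'a list \<Rightarrow> 'a trace" where
  "trace_of I w = {v. trace_cong I w v}"

definition trace_monoid :: "('a \<times> 'a) set \<Rightarrow> 'a trace monoid" where
  "trace_monoid I =
     \<lparr>carrier = range (trace_of I),
      monoid.mult = (\<lambda>x y. \<Union>u\<in>x. \<Union>v\<in>y. trace_of I (u @ v)),
      one = trace_of I []\<rparr>"

text \<open>
  The order \<open>x \<le> y\<close> on traces is left divisibility, i.e. \<open>x divides\<^bsub>trace_monoid I\<^esub> y\<close>.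
  All words in a trace have the same length and the same letters.
\<close>

definition trace_length :: "'a trace \<Rightarrow> nat" where
  "trace_length x = the_elem (length ` x)"

definition letters :: "'a trace \<Rightarrow> 'a set" where
  "letters x = (\<Union>w\<in>x. set w)"

definition trace_prod :: "('a \<times> 'a) set \<Rightarrow> 'a trace list \<Rightarrow> 'a trace" where
  "trace_prod I cs = foldr (\<otimes>\<^bsub>trace_monoid I\<^esub>) cs \<one>\<^bsub>trace_monoid I\<^esub>"

lemma trace_cong_length: "trace_cong I u v \<Longrightarrow> length u = length v"
  by (induction rule: trace_cong.induct) auto

lemma trace_cong_set: "trace_cong I u v \<Longrightarrow> set u = set v"
  by (induction rule: trace_cong.induct) auto

lemma trace_of_eq_iff: "trace_of I u = trace_of I v \<longleftrightarrow> trace_cong I u v"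
proof
  assume "trace_of I u = trace_of I v"
  then have "v \<in> trace_of I u" by (simp add: trace_of_def trace_cong.refl)
  then show "trace_cong I u v" by (simp add: trace_of_def)
next
  assume "trace_cong I u v"
  then show "trace_of I u = trace_of I v"
    unfolding trace_of_def by (blast intro: trace_cong.sym trace_cong.trans)
qed

lemma trace_length_trace_of: "trace_length (trace_of I w) = length w"
proof -
  have "length ` trace_of I w = {length w}"
    by (auto simp: trace_of_def image_iff dest: trace_cong_length intro: trace_cong.refl)
  then show ?thesis by (simp add: trace_length_def)
qed

lemma letters_trace_of: "letters (trace_of I w) = set w"
  by (auto simp: letters_def trace_of_def dest: trace_cong_set intro: trace_cong.refl)

lemma trace_mult_trace_of:
  "trace_of I u \<otimes>\<^bsub>trace_monoid I\<^esub> trace_of I v = trace_of I (u @ v)"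
proof -
  have "trace_of I (u' @ v') = trace_of I (u @ v)"
    if "u' \<in> trace_of I u" "v' \<in> trace_of I v" for u' v'
    using that unfolding trace_of_eq_iff
    by (intro trace_cong.append trace_cong.sym[of I u] trace_cong.sym[of I v]) (simp_all add: trace_of_def)
  moreover have "u \<in> trace_of I u" "v \<in> trace_of I v"
    by (simp_all add: trace_of_def trace_cong.refl)
  ultimately show ?thesis
    unfolding trace_monoid_def monoid.simps by blast
qed

lemma monoid_trace_monoid: "monoid (trace_monoid I)"
proof -
  have c: "carrier (trace_monoid I) = range (trace_of I)"
    and o: "\<one>\<^bsub>trace_monoid I\<^esub> = trace_of I []"
    by (simp_all add: trace_monoid_def)
  show ?thesis
    by (rule monoidI) (auto simp: c o trace_mult_trace_of)
qed

section \<open>Cliques, normal forms and the boundary\<close>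

definition cliques :: "('a \<times> 'a) set \<Rightarrow> 'a trace set" where
  "cliques I = {trace_of I w | w. distinct w \<and> (\<forall>a\<in>set w. \<forall>b\<in>set w. a \<noteq> b \<longrightarrow> (a, b) \<in> I)}"

definition ncliques :: "('a \<times> 'a) set \<Rightarrow> 'a trace set" where
  "ncliques I = cliques I - {\<one>\<^bsub>trace_monoid I\<^esub>}"

definition clique_arrow :: "('a \<times> 'a) set \<Rightarrow> 'a trace \<Rightarrow> 'a trace \<Rightarrow> bool" where
  "clique_arrow I c c' \<longleftrightarrow> (\<forall>b\<in>letters c'. \<exists>a\<in>letters c. (a, b) \<notin> I)"

text \<open>For the unit the normal form is the empty list, so that \<open>height I \<one> = 0\<close>.\<close>

definition is_normal_form :: "('a \<times> 'a) set \<Rightarrow> 'a trace \<Rightarrow> 'a trace list \<Rightarrow> bool" where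
  "is_normal_form I x cs \<longleftrightarrow>
     set cs \<subseteq> ncliques I \<and> successively (clique_arrow I) cs \<and> trace_prod I cs = x"

definition height :: "('a \<times> 'a) set \<Rightarrow> 'a trace \<Rightarrow> nat" where
  "height I x = length (THE cs. is_normal_form I x cs)"

text \<open>Sequences are indexed from \<open>0\<close>: \<open>\<xi> i\<close> is the clique usually written \<open>c\<^sub>i\<^sub>+\<^sub>1\<close>.\<close>

definition bdry :: "('a \<times> 'a) set \<Rightarrow> (nat \<Rightarrow> 'a trace) set" where
  "bdry I = {\<xi>. \<forall>i. \<xi> i \<in> ncliques I \<and> clique_arrow I (\<xi> i) (\<xi> (Suc i))}"

definition partial_prod :: "('a \<times> 'a) set \<Rightarrow> (nat \<Rightarrow> 'a trace) \<Rightarrow> nat \<Rightarrow> 'a trace" where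
  "partial_prod I \<xi> n = trace_prod I (map \<xi> [0..<n])"

definition trace_le_bdry :: "('a \<times> 'a) set \<Rightarrow> 'a trace \<Rightarrow> (nat \<Rightarrow> 'a trace) \<Rightarrow> bool" where
  "trace_le_bdry I x \<xi> \<longleftrightarrow> x divides\<^bsub>trace_monoid I\<^esub> partial_prod I \<xi> (height I x)"

definition cyl :: "('a \<times> 'a) set \<Rightarrow> 'a trace \<Rightarrow> (nat \<Rightarrow> 'a trace) set" where
  "cyl I x = {\<xi> \<in> bdry I. trace_le_bdry I x \<xi>}"

definition bdry_algebra :: "('a \<times> 'a) set \<Rightarrow> (nat \<Rightarrow> 'a trace) measure" where
  "bdry_algebra I = sigma (bdry I) (cyl I ` carrier (trace_monoid I))"

text \<open>
  The order on boundary elements compares all partial products; \<open>bdry_join I y \<xi>\<close> says that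
  \<open>\<xi>\<close> is the least upper bound in the boundary of the sequence of traces \<open>y\<close>.
\<close>

definition bdry_le :: "('a \<times> 'a) set \<Rightarrow> (nat \<Rightarrow> 'a trace) \<Rightarrow> (nat \<Rightarrow> 'a trace) \<Rightarrow> bool" where
  "bdry_le I \<xi> \<eta> \<longleftrightarrow>
     (\<forall>n. partial_prod I \<xi> n divides\<^bsub>trace_monoid I\<^esub> partial_prod I \<eta> n)"

definition bdry_join :: "('a \<times> 'a) set \<Rightarrow> (nat \<Rightarrow> 'a trace) \<Rightarrow> (nat \<Rightarrow> 'a trace) \<Rightarrow> bool" where
  "bdry_join I y \<xi> \<longleftrightarrow> \<xi> \<in> bdry I \<and> (\<forall>n. trace_le_bdry I (y n) \<xi>) \<and>
     (\<forall>\<eta>\<in>bdry I. (\<forall>n. trace_le_bdry I (y n) \<eta>) \<longrightarrow> bdry_le I \<xi> \<eta>)"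

section \<open>Fibred valuations and Markov measures\<close>

definition right_action :: "('a \<times> 'a) set \<Rightarrow> ('x \<Rightarrow> 'a trace \<Rightarrow> 'x) \<Rightarrow> bool" where
  "right_action I act \<longleftrightarrow>
     (\<forall>\<alpha>. act \<alpha> \<one>\<^bsub>trace_monoid I\<^esub> = \<alpha>) \<and>
     (\<forall>\<alpha>. \<forall>x\<in>carrier (trace_monoid I). \<forall>y\<in>carrier (trace_monoid I).
        act \<alpha> (x \<otimes>\<^bsub>trace_monoid I\<^esub> y) = act (act \<alpha> x) y)"

definition fibred_valuation ::
  "('a \<times> 'a) set \<Rightarrow> ('x \<Rightarrow> 'a trace \<Rightarrow> 'x) \<Rightarrow> ('x \<Rightarrow> 'a trace \<Rightarrow> real) \<Rightarrow> bool" where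
  "fibred_valuation I act f \<longleftrightarrow>
     (\<forall>\<alpha>. f \<alpha> \<one>\<^bsub>trace_monoid I\<^esub> = 1) \<and>
     (\<forall>\<alpha>. \<forall>x\<in>carrier (trace_monoid I). \<forall>y\<in>carrier (trace_monoid I).
        f \<alpha> (x \<otimes>\<^bsub>trace_monoid I\<^esub> y) = f \<alpha> x * f (act \<alpha> x) y)"

definition moebius_transform :: "('a \<times> 'a) set \<Rightarrow> ('a trace \<Rightarrow> real) \<Rightarrow> 'a trace \<Rightarrow> real" where
  "moebius_transform I f c =
     (\<Sum>c' | c' \<in> cliques I \<and> letters c \<subseteq> letters c'.
        (-1) ^ (trace_length c' - trace_length c) * f c')"

definition moebius_fibred_valuation ::
  "('a \<times> 'a) set \<Rightarrow> ('x \<Rightarrow> 'a trace \<Rightarrow> 'x) \<Rightarrow> ('x \<Rightarrow> 'a trace \<Rightarrow> real) \<Rightarrow> bool" where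
  "moebius_fibred_valuation I act f \<longleftrightarrow> fibred_valuation I act f \<and>
     (\<forall>\<alpha>. moebius_transform I (f \<alpha>) \<one>\<^bsub>trace_monoid I\<^esub> = 0) \<and>
     (\<forall>\<alpha>. \<forall>c\<in>ncliques I. moebius_transform I (f \<alpha>) c \<ge> 0)"

definition markov_measure ::
  "('a \<times> 'a) set \<Rightarrow> ('x \<Rightarrow> 'a trace \<Rightarrow> 'x) \<Rightarrow> ('x \<Rightarrow> (nat \<Rightarrow> 'a trace) measure) \<Rightarrow> bool" where
  "markov_measure I act P \<longleftrightarrow>
     (\<forall>\<alpha>. prob_space (P \<alpha>) \<and> sets (P \<alpha>) = sets (bdry_algebra I)) \<and>
     (\<forall>\<alpha>. \<forall>x\<in>carrier (trace_monoid I). \<forall>y\<in>carrier (trace_monoid I).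
        measure (P \<alpha>) (cyl I (x \<otimes>\<^bsub>trace_monoid I\<^esub> y)) =
        measure (P \<alpha>) (cyl I x) * measure (P (act \<alpha> x)) (cyl I y))"

section \<open>The Markov chain of states and cliques\<close>

definition g_fun :: "('a \<times> 'a) set \<Rightarrow> ('a trace \<Rightarrow> real) \<Rightarrow> 'a trace \<Rightarrow> real" where
  "g_fun I f c = (\<Sum>c' | c' \<in> ncliques I \<and> clique_arrow I c c'. moebius_transform I f c')"

definition transition ::
  "('a \<times> 'a) set \<Rightarrow> ('x \<Rightarrow> 'a trace \<Rightarrow> 'x) \<Rightarrow> ('x \<Rightarrow> 'a trace \<Rightarrow> real)
     \<Rightarrow> 'x \<times> 'a trace \<Rightarrow> 'x \<times> 'a trace \<Rightarrow> real" where
  "transition I act f = (\<lambda>(\<alpha>, c) (\<alpha>', c').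
     if \<alpha>' = act \<alpha> c \<and> clique_arrow I c c' \<and> g_fun I (f \<alpha>') c \<noteq> 0
     then moebius_transform I (f \<alpha>') c' / g_fun I (f \<alpha>') c else 0)"

definition initial_law ::
  "('a \<times> 'a) set \<Rightarrow> ('x \<Rightarrow> 'a trace \<Rightarrow> real) \<Rightarrow> 'x \<Rightarrow> 'x \<times> 'a trace \<Rightarrow> real" where
  "initial_law I f \<alpha> = (\<lambda>(\<alpha>', c). if \<alpha>' = \<alpha> then moebius_transform I (f \<alpha>) c else 0)"

text \<open>
  A row of the matrix \<open>p\<close> is only constrained at states that are visited with positive
  probability. This matters because \<open>transition\<close> has zero rows in general.
\<close>

definition markov_chain ::
  "'w measure \<Rightarrow> 's set \<Rightarrow> ('s \<Rightarrow> real) \<Rightarrow> ('s \<Rightarrow> 's \<Rightarrow> real) \<Rightarrow> (nat \<Rightarrow> 'w \<Rightarrow> 's) \<Rightarrow> bool" where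
  "markov_chain Q S \<nu> p Z \<longleftrightarrow>
     prob_space Q \<and>
     (\<forall>n. Z n \<in> measurable Q (count_space S)) \<and>
     (\<forall>s\<in>S. \<P>(\<omega> in Q. Z 0 \<omega> = s) = \<nu> s) \<and>
     (\<forall>n z. \<forall>s\<in>S. \<P>(\<omega> in Q. \<forall>i\<le>n. Z i \<omega> = z i) > 0 \<longrightarrow>
        \<P>(\<omega> in Q. Z (Suc n) \<omega> = s \<bar> \<forall>i\<le>n. Z i \<omega> = z i) = p (z n) s)"

end

theory Submission
  imports Defs
begin

text \<open>
  Let \<open>E(c\<^sub>1, \<dots>, c\<^sub>n)\<close> be the set of boundary elements that start with
  \<open>c\<^sub>1, \<dots>, c\<^sub>n\<close>. Moebius inversion on cliques gives
  \<open>h\<^sub>\<alpha>(c) = f\<^sub>\<alpha>(c) g\<^sub>\<alpha>\<^sub>\<cdot>\<^sub>c(c)\<close>, so the denominators in the transition matrix telescope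
  and the chain started at \<open>\<alpha>\<close> gives \<open>E(c\<^sub>1, \<dots>, c\<^sub>n)\<close> the weight
  \<open>f\<^sub>\<alpha>(y) h\<^sub>\<alpha>\<^sub>\<cdot>\<^sub>y(c\<^sub>n)\<close> with \<open>y = c\<^sub>1 \<dots> c\<^sub>n\<^sub>-\<^sub>1\<close>.

  To compute the mass of \<open>\<up>x\<close> for \<open>x\<close> of height \<open>n\<close>, consider for each trace \<open>y\<close> of
  height at most \<open>n\<close> the alternating sum of \<open>f\<^sub>\<alpha>(y d)\<close> over the cliques \<open>d\<close> for which
  \<open>y d\<close> still has height at most \<open>n\<close>. It is the weight of the normal form of \<open>y\<close> if \<open>y\<close>
  has height \<open>n\<close>, and it vanishes for smaller heights because \<open>h(1) = 0\<close>. On the other hand,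
  the cliques dividing a trace on the right are the subsets of a single clique, so
  summing over all \<open>y \<ge> x\<close> leaves only \<open>f\<^sub>\<alpha>(x)\<close>.

  Uniqueness holds because the sets \<open>E\<close> form a generating \<open>\<pi>\<close>-system whose masses are
  determined by those of the sets \<open>\<up>x\<close>: for \<open>x = c\<^sub>1 \<dots> c\<^sub>n\<close> in normal form, \<open>\<up>x\<close> is the
  disjoint union of \<open>E(c\<^sub>1, \<dots>, c\<^sub>n)\<close> and of the \<open>E\<close> of finitely many larger traces of height \<open>n\<close>.
\<close>

section \<open>Notation and elementary facts about the trace congruence\<close>

locale trace_alphabet =
  fixes I :: "('a::finite \<times> 'a) set"
  assumes irrefl: "irrefl I" and sym: "sym I"
begin

abbreviation cong (infix "\<simeq>" 50) where "u \<simeq> v \<equiv> trace_cong I u v"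

abbreviation tr :: "'a list \<Rightarrow> 'a trace" where "tr \<equiv> trace_of I"

abbreviation tmult (infixl "\<odot>" 70) where "x \<odot> y \<equiv> x \<otimes>\<^bsub>trace_monoid I\<^esub> y"

abbreviation traces :: "'a trace set" where "traces \<equiv> carrier (trace_monoid I)"

lemma indep_irrefl [simp]: "(a, a) \<notin> I"
  using irrefl by (simp add: irrefl_def)

lemma indep_sym: "(a, b) \<in> I \<longleftrightarrow> (b, a) \<in> I"
  using sym by (auto dest: symD)

lemma cong_refl [simp]: "u \<simeq> u"
  by (rule trace_cong.refl)

lemma cong_append: "u \<simeq> v \<Longrightarrow> u' \<simeq> v' \<Longrightarrow> u @ u' \<simeq> v @ v'"
  by (rule trace_cong.append)

lemmas cong_sym = trace_cong.sym[of I]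
lemmas cong_trans [trans] = trace_cong.trans[of I]

subsection \<open>Projections onto pairs of dependent letters\<close>

text \<open>A generating swap exchanges two distinct independent letters, and the projection onto a
  dependent pair retains at most one of them.\<close>

lemma cong_filter:
  "u \<simeq> v \<Longrightarrow> (a, b) \<notin> I \<Longrightarrow> filter (\<lambda>c. c = a \<or> c = b) u = filter (\<lambda>c. c = a \<or> c = b) v"
proof (induction rule: trace_cong.induct)
  case (swap x y)
  then have "(x, y) \<noteq> (a, b)" "(x, y) \<noteq> (b, a)" "x \<noteq> y"
    using indep_sym by auto
  then show ?case by auto
qed auto

lemma cong_commute: "(\<And>b. b \<in> set w \<Longrightarrow> (a, b) \<in> I) \<Longrightarrow> w @ [a] \<simeq> a # w"
proof (induction w)
  case (Cons c w)
  have "c # (w @ [a]) \<simeq> c # (a # w)"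
    using cong_append[OF cong_refl[of "[c]"] Cons.IH] Cons.prems by simp
  also have "c # (a # w) \<simeq> a # c # w"
    using cong_append[of "[c, a]" "[a, c]" w w] by (simp add: trace_cong.swap Cons.prems indep_sym[of c a])
  finally show ?case by simp
qed simp

lemma filter_eq_nil_iff_notin: "filter (\<lambda>c. c = a \<or> c = b) w = [] \<longleftrightarrow> a \<notin> set w \<and> b \<notin> set w"
  by (auto simp: filter_empty_conv)

text \<open>The projections are a complete invariant. If \<open>u\<close> starts with
  \<open>a\<close>, then every letter before the first \<open>a\<close> in \<open>v\<close> is
  independent of \<open>a\<close>, since otherwise a projection of \<open>v\<close> would start with
  a different letter. So \<open>a\<close> can be moved to the front of \<open>v\<close> and split
  off from both words.\<close>

lemma cong_if_filter:
  assumes "\<And>a b. (a, b) \<notin> I \<Longrightarrow> filter (\<lambda>c. c = a \<or> c = b) u = filter (\<lambda>c. c = a \<or> c = b) v"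
  shows "u \<simeq> v"
  using assms
proof (induction u arbitrary: v)
  case Nil
  have "\<forall>a. a \<notin> set v"
  proof
    fix a show "a \<notin> set v"
      using Nil[of a a] filter_eq_nil_iff_notin[of a a v] by simp
  qed
  then have "set v = {}" by (simp only: set_eq_iff) simp
  then show ?case by simp
next
  case (Cons a u)
  have "filter (\<lambda>c. c = a \<or> c = a) v \<noteq> []"
    using Cons.prems[of a a] by auto
  then have "a \<in> set v" by (auto simp: filter_empty_conv)
  then obtain v1 v2 where v: "v = v1 @ a # v2" "a \<notin> set v1"
    by (meson split_list_first)
  have indep: "(a, b) \<in> I" if "b \<in> set v1" for b
  proof (rule ccontr)
    assume "(a, b) \<notin> I"
    from Cons.prems[OF this] have eq: "a # filter (\<lambda>c. c = a \<or> c = b) u =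
        filter (\<lambda>c. c = a \<or> c = b) v1 @ filter (\<lambda>c. c = a \<or> c = b) (a # v2)"
      by (simp add: v)
    have "filter (\<lambda>c. c = a \<or> c = b) v1 \<noteq> []"
      using that by (auto simp: filter_empty_conv)
    then obtain x xs where x: "filter (\<lambda>c. c = a \<or> c = b) v1 = x # xs"
      by (cases "filter (\<lambda>c. c = a \<or> c = b) v1") auto
    then have "x \<in> set (filter (\<lambda>c. c = a \<or> c = b) v1)" by simp
    then have "x \<in> set v1" by simp
    moreover have "x = a" using eq x by simp
    ultimately show False using v by simp
  qed
  have "filter (\<lambda>c. c = b \<or> c = d) u = filter (\<lambda>c. c = b \<or> c = d) (v1 @ v2)" if "(b, d) \<notin> I" for b d
  proof (cases "a = b \<or> a = d")
    case True
    then have "filter (\<lambda>c. c = b \<or> c = d) v1 = []"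
      using indep that v(2) indep_sym by (auto simp: filter_empty_conv)
    with Cons.prems[OF that] v True show ?thesis by auto
  next
    case False
    with Cons.prems[OF that] v show ?thesis by auto
  qed
  from Cons.IH[OF this] have "u \<simeq> v1 @ v2" .
  then have "[a] @ u \<simeq> [a] @ (v1 @ v2)" by (intro cong_append cong_refl)
  also have "[a] @ (v1 @ v2) \<simeq> (v1 @ [a]) @ v2"
    using cong_append[OF cong_sym[OF cong_commute[of v1 a, OF indep]] cong_refl[of v2]] by simp
  finally show ?case by (simp add: v)
qed

lemma cong_iff_filter:
  "u \<simeq> v \<longleftrightarrow> (\<forall>a b. (a, b) \<notin> I \<longrightarrow> filter (\<lambda>c. c = a \<or> c = b) u = filter (\<lambda>c. c = a \<or> c = b) v)"
  using cong_filter cong_if_filter by blast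

text \<open>Projections are morphisms into free monoids, so cancellation is inherited from
  lists.\<close>

lemma cong_cancel_left: "w @ u \<simeq> w @ v \<longleftrightarrow> u \<simeq> v"
  by (simp add: cong_iff_filter)

lemma cong_cancel_right: "u @ w \<simeq> v @ w \<longleftrightarrow> u \<simeq> v"
  by (simp add: cong_iff_filter)

lemma cong_nil_iff [simp]: "w \<simeq> [] \<longleftrightarrow> w = []" "[] \<simeq> w \<longleftrightarrow> w = []"
  by (auto dest: trace_cong_length)

text \<open>A dependent pair meets the common letter set in at most one letter, so all projections
  have length at most one and cannot record any order.\<close>

lemma cong_distinct:
  assumes "distinct u" "distinct v" "set u = set v"
    and "\<And>a b. a \<in> set u \<Longrightarrow> b \<in> set u \<Longrightarrow> a \<noteq> b \<Longrightarrow> (a, b) \<in> I"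
  shows "u \<simeq> v"
proof (rule cong_if_filter)
  fix a b assume "(a, b) \<notin> I"
  then have "a = b \<or> a \<notin> set u \<or> b \<notin> set u" using assms(4) by blast
  then obtain x where x: "\<And>c. c \<in> set u \<Longrightarrow> (c = a \<or> c = b) \<longleftrightarrow> c = x"
    by (intro that[of "if a \<in> set u then a else b"]) auto
  have *: "filter (\<lambda>c. c = a \<or> c = b) w = (if x \<in> set w then [x] else [])"
    if "distinct w" "set w = set u" for w
  proof -
    have "filter (\<lambda>c. c = a \<or> c = b) w = filter (\<lambda>c. c = x) w"
      using x that(2) by (intro filter_cong) auto
    also have "\<dots> = (if x \<in> set w then [x] else [])"
      using that(1) by (induction w) auto
    finally show ?thesis .
  qed
  show "filter (\<lambda>c. c = a \<or> c = b) u = filter (\<lambda>c. c = a \<or> c = b) v"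
    using *[of u] *[of v] assms by simp
qed

subsection \<open>Right divisors\<close>

text \<open>The maximal pieces of the heap. They form the largest clique that divides the trace on
  the right, and its subsets are all the cliques with that property.\<close>

definition rights :: "'a list \<Rightarrow> 'a set" where
  "rights w = {a. \<exists>u. w \<simeq> u @ [a]}"

lemma rights_nil [simp]: "rights [] = {}"
  by (auto simp: rights_def)

lemma rights_empty_iff: "rights w = {} \<longleftrightarrow> w = []"
proof (cases w rule: rev_cases)
  case (snoc u a)
  then have "a \<in> rights w" unfolding rights_def by (blast intro: cong_refl)
  with snoc show ?thesis by auto
qed simp

lemma rights_cong: "u \<simeq> v \<Longrightarrow> rights u = rights v"
  unfolding rights_def by (blast intro: cong_trans cong_sym)

lemma rights_snoc: "w \<simeq> u @ [a] \<Longrightarrow> a \<in> rights w"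
  by (auto simp: rights_def)

text \<open>Split at the last \<open>a\<close> in \<open>w\<close>. A letter after it that depends
  on \<open>a\<close> would change the last letter of the projection onto that pair, which has to be
  \<open>a\<close>.\<close>

lemma rights_split:
  assumes "a \<in> rights w"
  obtains u v where "w = u @ a # v" "a \<notin> set v" "\<And>b. b \<in> set v \<Longrightarrow> (a, b) \<in> I"
proof -
  obtain w' where w': "w \<simeq> w' @ [a]" using assms by (auto simp: rights_def)
  then have "a \<in> set w" by (auto dest: trace_cong_set)
  then obtain u v where w: "w = u @ a # v" "a \<notin> set v"
    by (meson split_list_last)
  have "(a, b) \<in> I" if b: "b \<in> set v" for b
  proof (rule ccontr)
    let ?F = "filter (\<lambda>c. c = a \<or> c = b)"
    assume "(a, b) \<notin> I"
    from cong_filter[OF w' this] have "?F w = ?F w' @ [a]" by simp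
    then have "last (?F u @ a # ?F v) = a" by (simp add: w(1))
    moreover have ne: "?F v \<noteq> []" using b by (auto simp: filter_empty_conv)
    ultimately have "a \<in> set (?F v)" using last_in_set[OF ne] by simp
    then have "a \<in> set v" by simp
    with w show False by simp
  qed
  with w that show thesis by blast
qed

text \<open>If the two letters were dependent, their common projection would have to end with both
  of them.\<close>

lemma rights_clique:
  assumes "a \<in> rights w" "b \<in> rights w" "a \<noteq> b"
  shows "(a, b) \<in> I"
proof (rule ccontr)
  assume *: "(a, b) \<notin> I"
  obtain u v where "w \<simeq> u @ [a]" "w \<simeq> v @ [b]" using assms by (auto simp: rights_def)
  from cong_filter[OF this(1) *] cong_filter[OF this(2) *] assms(3) show False by simp
qed

text \<open>The letters of \<open>d\<close> are moved to the end one at a time: the last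
  \<open>b\<close> of \<open>u @ d\<close> lies in \<open>u\<close> and commutes with everything
  that follows it.\<close>

lemma cong_if_subset_rights: "distinct d \<Longrightarrow> set d \<subseteq> rights w \<Longrightarrow> \<exists>u. w \<simeq> u @ d"
proof (induction d)
  case Nil
  show ?case by (rule exI[of _ w]) simp
next
  case (Cons b d)
  then obtain u where u: "w \<simeq> u @ d" by auto
  have "b \<in> rights (u @ d)" using Cons.prems rights_cong[OF u] by auto
  then obtain x y where xy: "u @ d = x @ b # y" "\<And>c. c \<in> set y \<Longrightarrow> (b, c) \<in> I"
    by (rule rights_split) blast
  have "b \<notin> set d" using Cons.prems by simp
  have "b \<in> set u" using xy(1) \<open>b \<notin> set d\<close> by (metis Un_iff in_set_conv_decomp set_append)
  then obtain x' z where z': "u = x' @ b # z" "b \<notin> set z" by (meson split_list_last)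
  \<comment> \<open>Both decompositions split the same word at its last \<open>b\<close>.\<close>
  have "x' = x \<and> z @ d = y"
  proof -
    have "x' @ b # (z @ d) = x @ b # y" "b \<notin> set (z @ d)" "b \<notin> set y"
      using xy(1) xy(2)[of b] z' \<open>b \<notin> set d\<close> by auto
    then show ?thesis
      by (auto simp only: append_eq_append_conv2 append_eq_Cons_conv Cons_eq_append_conv) auto
  qed
  then have z: "u = x @ b # z" "y = z @ d" using z' by auto
  have "u \<simeq> x @ (z @ [b])"
    unfolding z(1) by (intro cong_append cong_refl cong_sym[OF cong_commute]) (use xy z in auto)
  then have "u @ d \<simeq> (x @ z) @ (b # d)" using cong_append[OF _ cong_refl[of d]] by fastforce
  with u show ?case by (blast intro: cong_trans)
qed

lemma subset_rights_if_cong: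
  assumes "distinct d" "\<And>a b. a \<in> set d \<Longrightarrow> b \<in> set d \<Longrightarrow> a \<noteq> b \<Longrightarrow> (a, b) \<in> I" "w \<simeq> u @ d"
  shows "set d \<subseteq> rights w"
proof
  fix a assume a: "a \<in> set d"
  have "d \<simeq> remove1 a d @ [a]"
    using assms(1,2) a by (intro cong_distinct) auto
  with assms(3) have "w \<simeq> (u @ remove1 a d) @ [a]"
    by (metis append.assoc cong_append cong_refl cong_trans)
  then show "a \<in> rights w" by (rule rights_snoc)
qed

subsection \<open>Levels\<close>

text \<open>
  Letters are piled up as in a heap of pieces: a new letter lands just above the highest letter
  that it does not commute with, and \<open>lev w a\<close> is the level of the last \<open>a\<close> in \<open>w\<close>.
\<close>

definition add_lev :: "('a \<Rightarrow> nat) \<Rightarrow> 'a \<Rightarrow> 'a \<Rightarrow> nat" where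
  "add_lev l a = l(a := Suc (Max (l ` {b. (a, b) \<notin> I})))"

definition lev :: "'a list \<Rightarrow> 'a \<Rightarrow> nat" where
  "lev w = foldl add_lev (\<lambda>_. 0) w"

text \<open>The number of layers of the heap; \<open>height_tr\<close> identifies it with the length
  of the normal form.\<close>

definition ht :: "'a list \<Rightarrow> nat" where
  "ht w = Max (range (lev w))"

lemma lev_nil [simp]: "lev [] a = 0"
  by (simp add: lev_def)

lemma lev_snoc: "lev (w @ [a]) = (lev w)(a := Suc (Max (lev w ` {b. (a, b) \<notin> I})))"
  by (simp add: lev_def add_lev_def)

lemma lev_le_Max: "(a, b) \<notin> I \<Longrightarrow> lev w b \<le> Max (lev w ` {b. (a, b) \<notin> I})"
  by (intro Max_ge) auto

lemma lev_attained: obtains b where "(a, b) \<notin> I" "lev w b = Max (lev w ` {b. (a, b) \<notin> I})"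
proof -
  have "Max (lev w ` {b. (a, b) \<notin> I}) \<in> lev w ` {b. (a, b) \<notin> I}"
  proof (rule Max_in)
    show "lev w ` {b. (a, b) \<notin> I} \<noteq> {}" using indep_irrefl[of a] by blast
  qed simp
  with that show thesis by auto
qed

text \<open>Placing a letter does not change the levels seen by a letter independent of it, so the
  two updates commute. The starting function \<open>l\<close> is arbitrary so that the induction
  passes through concatenations.\<close>

lemma foldl_add_lev_cong: "u \<simeq> v \<Longrightarrow> foldl add_lev l u = foldl add_lev l v"
proof (induction arbitrary: l rule: trace_cong.induct)
  case (swap a b)
  have *: "(l(x := k)) ` {c. (y, c) \<notin> I} = l ` {c. (y, c) \<notin> I}" if "(y, x) \<in> I" for x y k
    using that by (intro image_cong) auto
  have "a \<noteq> b" "(b, a) \<in> I" using swap indep_sym by auto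
  with swap show ?case
    by (simp add: add_lev_def * fun_upd_twist[of a b] del: fun_upd_apply)
qed auto

lemma lev_cong: "u \<simeq> v \<Longrightarrow> lev u = lev v"
  unfolding lev_def by (rule foldl_add_lev_cong)

text \<open>Distinct letters of a clique do not see each other, so each lands as if it were added to
  \<open>w\<close> alone.\<close>

lemma lev_append_clique:
  assumes "distinct d" "\<And>a b. a \<in> set d \<Longrightarrow> b \<in> set d \<Longrightarrow> a \<noteq> b \<Longrightarrow> (a, b) \<in> I"
  shows "lev (w @ d) a = (if a \<in> set d then Suc (Max (lev w ` {b. (a, b) \<notin> I})) else lev w a)"
  using assms
proof (induction d arbitrary: a rule: rev_induct)
  case (snoc c d)
  have IH: "lev (w @ d) a = (if a \<in> set d then Suc (Max (lev w ` {b. (a, b) \<notin> I})) else lev w a)" for a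
    using snoc.prems by (intro snoc.IH) auto
  have "lev (w @ d) ` {b. (c, b) \<notin> I} = lev w ` {b. (c, b) \<notin> I}"
    using snoc.prems by (intro image_cong) (auto simp: IH)
  then show ?case
    using snoc.prems by (simp add: lev_snoc flip: append_assoc) (auto simp: IH)
qed simp

lemma lev_le_ht: "lev w a \<le> ht w"
  unfolding ht_def by (intro Max_ge) auto

lemma ht_attained: obtains a where "lev w a = ht w"
proof -
  have "ht w \<in> range (lev w)" unfolding ht_def by (intro Max_in) auto
  with that show thesis by auto
qed

text \<open>Every letter depends on itself, so a new occurrence lands above the earlier
  ones.\<close>

lemma lev_append_mono: "lev w a \<le> lev (w @ v) a"
proof (induction v rule: rev_induct)
  case (snoc c v)
  have "lev (w @ v) c \<le> Max (lev (w @ v) ` {b. (c, b) \<notin> I})" by (rule lev_le_Max) simp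
  with snoc show ?case 
    by (auto simp: lev_snoc le_Suc_eq intro: order_trans simp flip: append_assoc)
qed simp

lemma ht_append_mono: "ht w \<le> ht (w @ v)"
  by (metis ht_attained lev_append_mono lev_le_ht order_trans)

lemma ht_nil [simp]: "ht [] = 0"
  by (metis ht_attained lev_nil)

lemma ht_pos: "w \<noteq> [] \<Longrightarrow> ht w > 0"
proof -
  assume "w \<noteq> []"
  then obtain v a where "w = v @ [a]" by (meson rev_exhaust)
  then show ?thesis using lev_le_ht[of w a] by (simp add: lev_snoc)
qed

text \<open>A later letter dependent on a top letter would land above it. Hence the letters added
  after a top letter commute with it, and it can be moved to the end.\<close>

lemma top_in_rights: "lev w a = ht w \<Longrightarrow> w \<noteq> [] \<Longrightarrow> a \<in> rights w"
proof (induction w rule: rev_induct)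
  case (snoc b w)
  show ?case
  proof (cases "a = b")
    case True
    then show ?thesis by (intro rights_snoc[of _ w]) simp
  next
    case False
    have 1: "lev w a = ht (w @ [b])" using snoc.prems False by (simp add: lev_snoc)
    have 2: "(b, a) \<in> I"
    proof (rule ccontr)
      assume "(b, a) \<notin> I"
      from lev_le_Max[OF this, of w] 1 have "ht (w @ [b]) < lev (w @ [b]) b"
        by (simp add: lev_snoc)
      with lev_le_ht[of "w @ [b]" b] show False by simp
    qed
    have "ht w \<le> ht (w @ [b])" by (rule ht_append_mono)
    with 1 lev_le_ht[of w a] have "lev w a = ht w" by simp
    moreover have "w \<noteq> []" using 1 ht_pos[of "w @ [b]"] by auto
    ultimately obtain u where u: "w \<simeq> u @ [a]" using snoc.IH by (auto simp: rights_def)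
    then have "w @ [b] \<simeq> u @ [a, b]" using cong_append[OF u cong_refl[of "[b]"]] by simp
    also have "u @ [a, b] \<simeq> u @ [b, a]"
      by (intro cong_append cong_refl trace_cong.swap) (use 2 indep_sym in auto)
    finally show ?thesis by (intro rights_snoc[of _ "u @ [b]"]) simp
  qed
qed simp

subsection \<open>Cliques as sets of letters\<close>

definition indep_set :: "'a set \<Rightarrow> bool" where
  "indep_set D \<longleftrightarrow> (\<forall>a\<in>D. \<forall>b\<in>D. a \<noteq> b \<longrightarrow> (a, b) \<in> I)"

text \<open>For independent \<open>D\<close> the chosen word does not matter, by
  \<open>cong_distinct\<close>. Sums over cliques thereby become sums over sets of letters.\<close>

definition clique :: "'a set \<Rightarrow> 'a trace" where
  "clique D = tr (SOME d. distinct d \<and> set d = D)"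

text \<open>This set contains \<open>D\<close>. For cliques it plays two roles:
  \<open>E \<subseteq> dep D\<close> says that \<open>E\<close> may follow \<open>D\<close> in a
  normal form, and \<open>E \<inter> dep D = {}\<close> says that \<open>E\<close> is disjoint from
  \<open>D\<close> and can be merged with it into one clique.\<close>

definition dep :: "'a set \<Rightarrow> 'a set" where
  "dep D = {b. \<exists>a\<in>D. (a, b) \<notin> I}"

lemma traces_eq: "traces = range tr"
  by (simp add: trace_monoid_def)

lemma one_eq: "\<one>\<^bsub>trace_monoid I\<^esub> = tr []"
  by (simp add: trace_monoid_def)

lemma tr_in_traces [simp]: "tr w \<in> traces"
  by (simp add: traces_eq)

sublocale tm: monoid "trace_monoid I"
  by (rule monoid_trace_monoid)

lemma traceE: "x \<in> traces \<Longrightarrow> (\<And>w. x = tr w \<Longrightarrow> thesis) \<Longrightarrow> thesis"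
  by (auto simp: traces_eq)

lemma tmult_cancel_left: "x \<in> traces \<Longrightarrow> y \<in> traces \<Longrightarrow> z \<in> traces \<Longrightarrow> x \<odot> y = x \<odot> z \<longleftrightarrow> y = z"
  by (elim traceE) (simp add: trace_mult_trace_of trace_of_eq_iff cong_cancel_left)

lemma tmult_cancel_right: "x \<in> traces \<Longrightarrow> y \<in> traces \<Longrightarrow> z \<in> traces \<Longrightarrow> y \<odot> x = z \<odot> x \<longleftrightarrow> y = z"
  by (elim traceE) (simp add: trace_mult_trace_of trace_of_eq_iff cong_cancel_right)

lemma indep_set_mono: "indep_set D \<Longrightarrow> E \<subseteq> D \<Longrightarrow> indep_set E"
  unfolding indep_set_def by blast

lemma indep_set_empty [simp]: "indep_set {}"
  by (simp add: indep_set_def)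

lemma clique_word:
  assumes "indep_set D"
  obtains d where "distinct d" "set d = D" "clique D = tr d"
proof -
  obtain d where "distinct d \<and> set d = D"
    using finite_distinct_list[of D] by auto
  then have "distinct (SOME d. distinct d \<and> set d = D) \<and> set (SOME d. distinct d \<and> set d = D) = D"
    by (rule someI)
  with that show thesis unfolding clique_def by blast
qed

lemma clique_eq:
  assumes "indep_set (set d)" "distinct d"
  shows "clique (set d) = tr d"
proof -
  obtain e where e: "distinct e" "set e = set d" "clique (set d) = tr e"
    using assms(1) by (rule clique_word)
  have "e \<simeq> d"
    using assms e by (intro cong_distinct) (auto simp: indep_set_def)
  with e show ?thesis by (simp add: trace_of_eq_iff)
qed

lemma clique_empty [simp]: "clique {} = \<one>\<^bsub>trace_monoid I\<^esub>"
  using clique_eq[of "[]"] by (simp add: one_eq)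

lemma clique_in_traces [simp]: "clique D \<in> traces"
  by (simp add: clique_def)

lemma letters_clique [simp]: "indep_set D \<Longrightarrow> letters (clique D) = D"
  by (metis clique_word letters_trace_of)

lemma trace_length_clique [simp]: "indep_set D \<Longrightarrow> trace_length (clique D) = card D"
  by (metis clique_word distinct_card trace_length_trace_of)

lemma clique_eq_iff: "indep_set D \<Longrightarrow> indep_set E \<Longrightarrow> clique D = clique E \<longleftrightarrow> D = E"
  by (metis letters_clique)

lemma cliques_eq: "cliques I = clique ` Collect indep_set"
proof
  show "cliques I \<subseteq> clique ` Collect indep_set"
  proof
    fix c assume "c \<in> cliques I"
    then obtain w where w: "c = tr w" "distinct w" "indep_set (set w)"
      by (auto simp: cliques_def indep_set_def)
    then have "c = clique (set w)" by (simp add: clique_eq)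
    with w show "c \<in> clique ` Collect indep_set" by blast
  qed
  show "clique ` Collect indep_set \<subseteq> cliques I"
  proof
    fix c assume "c \<in> clique ` Collect indep_set"
    then obtain D where D: "indep_set D" "c = clique D" by auto
    obtain d where "distinct d" "set d = D" "clique D = tr d" using D(1) by (rule clique_word)
    with D show "c \<in> cliques I"
      unfolding cliques_def indep_set_def by blast
  qed
qed

lemma ncliques_eq: "ncliques I = clique ` {D. indep_set D \<and> D \<noteq> {}}"
proof -
  have "clique D \<noteq> clique {}" if "indep_set D" "D \<noteq> {}" for D
    using that clique_eq_iff indep_set_empty by blast
  then show ?thesis unfolding ncliques_def cliques_eq by (auto simp: image_iff)
qed

lemma ncliqueE:
  assumes "c \<in> ncliques I"
  obtains D where "indep_set D" "D \<noteq> {}" "c = clique D"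
  using assms by (auto simp: ncliques_eq)

lemma finite_ncliques [simp]: "finite (ncliques I)"
  by (simp add: ncliques_eq)

lemma ncliques_subset: "ncliques I \<subseteq> traces"
  by (auto simp: ncliques_eq)

lemma clique_arrow_clique:
  "indep_set D \<Longrightarrow> indep_set E \<Longrightarrow> clique_arrow I (clique D) (clique E) \<longleftrightarrow> E \<subseteq> dep D"
  by (auto simp: clique_arrow_def dep_def)

lemma clique_union:
  assumes "indep_set (D \<union> E)" "D \<inter> E = {}"
  shows "clique (D \<union> E) = clique D \<odot> clique E"
proof -
  obtain d e where d: "distinct d" "set d = D" "clique D = tr d"
    and e: "distinct e" "set e = E" "clique E = tr e"
    by (meson assms(1) clique_word indep_set_mono Un_upper1 Un_upper2)
  have "clique (set (d @ e)) = tr (d @ e)"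
    using assms d e by (intro clique_eq) auto
  with d e show ?thesis by (simp add: trace_mult_trace_of)
qed

subsection \<open>Normal forms\<close>

definition normal :: "'a trace list \<Rightarrow> bool" where
  "normal cs \<longleftrightarrow> set cs \<subseteq> ncliques I \<and> successively (clique_arrow I) cs"

lemma is_normal_form_iff: "is_normal_form I x cs \<longleftrightarrow> normal cs \<and> trace_prod I cs = x"
  by (auto simp: is_normal_form_def normal_def)

lemma normal_nil [simp]: "normal []"
  by (simp add: normal_def)

lemma normal_snoc:
  "normal (cs @ [c]) \<longleftrightarrow> normal cs \<and> c \<in> ncliques I \<and> (cs = [] \<or> clique_arrow I (last cs) c)"
  by (auto simp: normal_def successively_append_iff)

lemma trace_prod_nil [simp]: "trace_prod I [] = \<one>\<^bsub>trace_monoid I\<^esub>"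
  by (simp add: trace_prod_def)

lemma trace_prod_in_traces [simp]: "set cs \<subseteq> traces \<Longrightarrow> trace_prod I cs \<in> traces"
  by (induction cs) (auto simp: trace_prod_def)

lemma trace_prod_append:
  "set cs \<subseteq> traces \<Longrightarrow> set ds \<subseteq> traces \<Longrightarrow>
     trace_prod I (cs @ ds) = trace_prod I cs \<odot> trace_prod I ds"
proof (induction cs)
  case (Cons c cs)
  have "trace_prod I (c # cs) = c \<odot> trace_prod I cs" for c cs by (simp add: trace_prod_def)
  with Cons show ?case by (simp add: tm.m_assoc)
qed simp

lemma trace_prod_snoc:
  "set cs \<subseteq> traces \<Longrightarrow> c \<in> traces \<Longrightarrow> trace_prod I (cs @ [c]) = trace_prod I cs \<odot> c"
  using trace_prod_append[of cs "[c]"] by (simp add: trace_prod_def)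

lemma normal_subset_traces: "normal cs \<Longrightarrow> set cs \<subseteq> traces"
  using ncliques_subset by (auto simp: normal_def)

lemma trace_prod_normal [simp]: "normal cs \<Longrightarrow> trace_prod I cs \<in> traces"
  by (simp add: normal_subset_traces)

text \<open>In the word of a normal form, the letters of the \<open>k\<close>-th clique end up at level \<open>k\<close>.\<close>

lemma normal_lev:
  assumes "normal cs" "trace_prod I cs = tr w"
  shows "lev w a \<le> length cs" "cs \<noteq> [] \<Longrightarrow> lev w a = length cs \<longleftrightarrow> a \<in> letters (last cs)"
proof -
  have "(\<forall>a. lev w a \<le> length cs) \<and>
        (cs \<noteq> [] \<longrightarrow> (\<forall>a. lev w a = length cs \<longleftrightarrow> a \<in> letters (last cs)))"
    using assms
  proof (induction cs arbitrary: w rule: rev_induct)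
    case Nil
    then have "w = []" by (simp add: one_eq trace_of_eq_iff)
    then show ?case by simp
  next
    case (snoc c cs)
    have cs: "normal cs" "c \<in> ncliques I" "cs = [] \<or> clique_arrow I (last cs) c"
      using snoc.prems by (auto simp: normal_snoc)
    obtain D where D: "indep_set D" "D \<noteq> {}" "c = clique D" using cs(2) by (rule ncliqueE)
    obtain d where d: "distinct d" "set d = D" "clique D = tr d" using D(1) by (rule clique_word)
    have "trace_prod I cs \<in> traces" using cs by simp
    then obtain u where u: "trace_prod I cs = tr u" by (auto simp: traces_eq)
    have "tr w = tr (u @ d)"
      using snoc.prems trace_prod_snoc[OF normal_subset_traces[OF cs(1)], of c] u D d
      by (simp add: trace_mult_trace_of)
    then have "lev w = lev (u @ d)" by (intro lev_cong) (simp add: trace_of_eq_iff)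
    then have w: "lev w a = (if a \<in> D then Suc (Max (lev u ` {b. (a, b) \<notin> I})) else lev u a)" for a
      using lev_append_clique[of d u a] d D by (simp add: indep_set_def)
    note IH = snoc.IH[OF cs(1) u]
    have le: "Max (lev u ` {b. (a, b) \<notin> I}) \<le> length cs" for a
      using lev_attained[of a u] IH by metis
    \<comment> \<open>By the arrow condition, \<open>a\<close> depends on a letter of the previous
      clique, which sits at level \<open>length cs\<close>; no level of \<open>u\<close> is
      higher.\<close>
    have "Max (lev u ` {b. (a, b) \<notin> I}) = length cs" if a: "a \<in> D" for a
    proof (cases "cs = []")
      case False
      with cs(3) a D obtain b where "b \<in> letters (last cs)" "(b, a) \<notin> I"
        by (auto simp: clique_arrow_def)
      then have "lev u b = length cs" "(a, b) \<notin> I" using IH False indep_sym by auto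
      with lev_le_Max[of a b u] le[of a] show ?thesis by simp
    qed (use le[of a] in simp)
    moreover have "lev u a \<noteq> Suc (length cs)" for a using IH by (metis not_less_eq_eq order_refl)
    ultimately show ?case using IH D by (auto simp: w le_SucI)
  qed
  then show "lev w a \<le> length cs" "cs \<noteq> [] \<Longrightarrow> lev w a = length cs \<longleftrightarrow> a \<in> letters (last cs)"
    by auto
qed

lemma normal_ht:
  assumes "normal cs" "trace_prod I cs = tr w"
  shows "ht w = length cs"
proof (cases "cs = []")
  case True
  then have "w = []" using assms by (simp add: one_eq trace_of_eq_iff)
  then show ?thesis using True by simp
next
  case False
  then have "last cs \<in> ncliques I" using assms(1) by (auto simp: normal_def)
  then obtain a where "a \<in> letters (last cs)" by (metis ncliqueE ex_in_conv letters_clique)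
  then have "lev w a = length cs" using normal_lev[OF assms] False by simp
  moreover obtain b where "lev w b = ht w" by (rule ht_attained)
  ultimately show ?thesis using lev_le_ht[of w a] normal_lev(1)[OF assms, of b] by simp
qed

text \<open>The trace determines the number of cliques and the last clique through its levels; the
  last clique is then cancelled.\<close>

lemma normal_unique:
  assumes "normal cs" "normal ds" "trace_prod I cs = trace_prod I ds"
  shows "cs = ds"
proof -
  have "trace_prod I cs \<in> traces" using assms by simp
  then obtain w where "trace_prod I cs = tr w" by (auto simp: traces_eq)
  then have "length cs = length ds" using normal_ht assms by metis
  then show ?thesis using assms
  proof (induction cs ds rule: rev_induct2)
    case (4 c cs d ds)
    have c: "normal cs" "c \<in> ncliques I" and d: "normal ds" "d \<in> ncliques I"
      using 4 by (auto simp: normal_snoc)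
    have "trace_prod I (cs @ [c]) \<in> traces" using 4 trace_prod_normal by blast
    then obtain w where w: "trace_prod I (cs @ [c]) = tr w" by (auto simp: traces_eq)
    have "letters c = letters d"
      using normal_lev(2)[of "cs @ [c]" w] normal_lev(2)[of "ds @ [d]" w] w 4 by auto
    then have "c = d" using c(2) d(2) by (auto simp: ncliques_eq)
    moreover have "trace_prod I cs = trace_prod I ds"
      using 4 \<open>c = d\<close> c d
      by (simp add: trace_prod_snoc normal_subset_traces ncliques_subset[THEN subsetD] tmult_cancel_right)
    ultimately show ?case using 4 c d by simp
  qed auto
qed

text \<open>Split off the top layer of the heap as the last clique and continue with the shorter
  remaining word.\<close>

lemma normal_exists: "\<exists>cs. normal cs \<and> trace_prod I cs = tr w"
proof (induction "length w" arbitrary: w rule: less_induct)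
  case less
  show ?case
  proof (cases "w = []")
    case True
    then show ?thesis by (intro exI[of _ "[]"]) (simp add: one_eq)
  next
    case False
    define D where "D = {a. lev w a = ht w}"
    have D: "D \<subseteq> rights w" using top_in_rights False by (auto simp: D_def)
    have "indep_set D" using D rights_clique unfolding indep_set_def by blast
    then obtain d where d: "distinct d" "set d = D" "clique D = tr d" by (rule clique_word)
    obtain u where u: "w \<simeq> u @ d" using cong_if_subset_rights d D by blast
    obtain a where "lev w a = ht w" by (rule ht_attained)
    then have "D \<noteq> {}" by (auto simp: D_def)
    then have "length u < length w" using trace_cong_length[OF u] d by auto
    then obtain cs where cs: "normal cs" "trace_prod I cs = tr u" using less by blast
    have lev: "lev w a = (if a \<in> D then Suc (Max (lev u ` {b. (a, b) \<notin> I})) else lev u a)" for a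
      using lev_append_clique[of d u a] d \<open>indep_set D\<close> lev_cong[OF u] by (simp add: indep_set_def)
    \<comment> \<open>A highest letter of \<open>u\<close> either belongs to \<open>D\<close>, and
      its new occurrence lands higher, or it is below the top of \<open>w\<close> by the choice of
      \<open>D\<close>.\<close>
    have "ht u < ht w"
    proof -
      obtain a where a: "lev u a = ht u" by (rule ht_attained)
      show ?thesis
      proof (cases "a \<in> D")
        case True
        then have "lev u a < lev w a" 
          using lev[of a] lev_le_Max[of a a u, OF indep_irrefl]
          by (simp only: True if_True less_Suc_eq_le)
        with a True show ?thesis by (simp add: D_def)
      next
        case False
        then have "lev w a \<noteq> ht w" by (simp add: D_def)
        moreover have "lev w a = lev u a" using lev[of a] False by simp
        ultimately show ?thesis using a lev_le_ht[of w a] by simp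
      qed
    qed
    \<comment> \<open>A letter of \<open>D\<close> lands at level \<open>ht w\<close>, so it rests
      on a dependent letter of \<open>u\<close> at level \<open>ht w - 1\<close>. This is the top
      level of \<open>u\<close>, whose letters are those of \<open>last cs\<close>.\<close>
    have "clique_arrow I (last cs) (clique D)" if "cs \<noteq> []"
      unfolding clique_arrow_def
    proof
      fix a assume "a \<in> letters (clique D)"
      then have a: "a \<in> D" using \<open>indep_set D\<close> by simp
      obtain b where b: "(a, b) \<notin> I" "lev u b = Max (lev u ` {b. (a, b) \<notin> I})"
        by (rule lev_attained)
      then have "Suc (lev u b) = ht w" using lev[of a] a by (simp add: D_def)
      then have "lev u b = length cs"
        using \<open>ht u < ht w\<close> lev_le_ht[of u b] normal_ht[OF cs] by simp
      then have "b \<in> letters (last cs)" using normal_lev(2)[OF cs that] by simp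
      with b show "\<exists>b\<in>letters (last cs). (b, a) \<notin> I" using indep_sym by blast
    qed
    then have "normal (cs @ [clique D])"
      using cs \<open>indep_set D\<close> \<open>D \<noteq> {}\<close> by (auto simp: normal_snoc ncliques_eq)
    moreover have "trace_prod I (cs @ [clique D]) = tr w"
      using cs d u by (simp add: trace_prod_snoc normal_subset_traces trace_mult_trace_of trace_of_eq_iff cong_sym)
    ultimately show ?thesis by blast
  qed
qed

section \<open>Heights of products\<close>

lemma height_prod: "normal cs \<Longrightarrow> height I (trace_prod I cs) = length cs"
  unfolding height_def is_normal_form_iff
  by (rule arg_cong[where f = length], rule the_equality) (auto intro: normal_unique)

lemma height_tr: "height I (tr w) = ht w"
  using normal_exists[of w] height_prod normal_ht by metis

lemma normal_form_exists:
  assumes "x \<in> traces"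
  obtains cs where "normal cs" "trace_prod I cs = x" "length cs = height I x"
  using assms normal_exists height_prod by (metis imageE traces_eq)

lemma height_le_mult: "x \<in> traces \<Longrightarrow> y \<in> traces \<Longrightarrow> height I x \<le> height I (x \<odot> y)"
  using ht_append_mono by (auto simp: traces_eq trace_mult_trace_of height_tr)

lemma height_mult_clique_le:
  assumes "x \<in> traces" "indep_set D"
  shows "height I (x \<odot> clique D) \<le> Suc (height I x)"
proof -
  obtain w where w: "x = tr w" using assms by (auto simp: traces_eq)
  obtain d where d: "distinct d" "set d = D" "clique D = tr d" using assms(2) by (rule clique_word)
  obtain a where "lev (w @ d) a = ht (w @ d)" by (rule ht_attained)
  moreover have "Max (lev w ` {b. (a, b) \<notin> I}) \<le> ht w"
    using lev_attained[of a w] lev_le_ht by metis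
  then have "lev (w @ d) a \<le> Suc (ht w)"
    using lev_append_clique[of d w a] d assms(2) lev_le_ht[of w a] by (simp add: indep_set_def)
  ultimately show ?thesis by (simp add: w d height_tr trace_mult_trace_of)
qed

text \<open>No new layer is started exactly when each letter of \<open>D\<close> sees only levels
  below the top one, that is, when it is independent of the letters of the last clique.\<close>

lemma height_mult_clique_iff:
  assumes "normal cs" "cs \<noteq> []" "indep_set D"
  shows "height I (trace_prod I cs \<odot> clique D) \<le> length cs \<longleftrightarrow> D \<inter> dep (letters (last cs)) = {}"
proof -
  obtain w where w: "trace_prod I cs = tr w"
    using trace_prod_normal[OF assms(1)] by (auto simp: traces_eq)
  obtain d where d: "distinct d" "set d = D" "clique D = tr d" using assms(3) by (rule clique_word)
  note lev = normal_lev[OF assms(1) w] normal_lev(2)[OF assms(1) w assms(2)]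
  have *: "Max (lev w ` {b. (a, b) \<notin> I}) < length cs \<longleftrightarrow> a \<notin> dep (letters (last cs))" for a
  proof -
    have "{b. (a, b) \<notin> I} \<noteq> {}" using indep_irrefl by blast
    then have "Max (lev w ` {b. (a, b) \<notin> I}) < length cs \<longleftrightarrow> (\<forall>b. (a, b) \<notin> I \<longrightarrow> lev w b < length cs)"
      by (subst Max_less_iff) auto
    also have "\<dots> \<longleftrightarrow> (\<forall>b. (a, b) \<notin> I \<longrightarrow> b \<notin> letters (last cs))"
      using lev by (metis le_neq_implies_less less_irrefl)
    also have "\<dots> \<longleftrightarrow> a \<notin> dep (letters (last cs))" using indep_sym by (auto simp: dep_def)
    finally show ?thesis .
  qed
  have "ht (w @ d) \<le> length cs \<longleftrightarrow> (\<forall>a. lev (w @ d) a \<le> length cs)"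
    by (simp add: ht_def)
  also have "\<dots> \<longleftrightarrow> (\<forall>a\<in>D. a \<notin> dep (letters (last cs)))"
  proof -
    have "lev (w @ d) a \<le> length cs \<longleftrightarrow> a \<in> D \<longrightarrow> a \<notin> dep (letters (last cs))" for a
      using lev_append_clique[of d w a] d assms(3) lev(1)[of a] *[of a]
      by (simp add: indep_set_def Suc_le_eq)
    then show ?thesis by blast
  qed
  finally show ?thesis by (auto simp: w d height_tr trace_mult_trace_of)
qed

lemma finite_normal: "finite {cs. normal cs \<and> length cs \<le> n}"
  by (rule finite_subset[OF _ finite_lists_length_le[OF finite_ncliques, of n]]) (auto simp: normal_def)

lemma finite_height_le: "finite {x \<in> traces. height I x \<le> n}"
proof (rule finite_subset[OF _ finite_imageI[OF finite_normal, of "trace_prod I" n]])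
  show "{x \<in> traces. height I x \<le> n} \<subseteq> trace_prod I ` {cs. normal cs \<and> length cs \<le> n}"
  proof
    fix x assume x: "x \<in> {x \<in> traces. height I x \<le> n}"
    then obtain cs where "normal cs" "trace_prod I cs = x" "length cs = height I x"
      using normal_form_exists by blast
    with x show "x \<in> trace_prod I ` {cs. normal cs \<and> length cs \<le> n}" by auto
  qed
qed

end

text \<open>Expand the product of the factors \<open>1 - 1\<close> over \<open>A\<close>.\<close>

lemma sum_alternating_Pow:
  assumes "finite A"
  shows "(\<Sum>X\<in>Pow A. (-1) ^ card X) = (if A = {} then 1 else 0 :: real)"
proof -
  have "(\<Prod>x\<in>A. 1 - 1 :: real) = (\<Sum>X\<in>Pow A. (-1) ^ card X * (\<Prod>x\<in>X. 1) * (\<Prod>x\<in>A - X. 1))"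
    using assms by (rule prod_diff_conv_sum)
  moreover have "(\<Prod>x\<in>A. 1 - 1 :: real) = (if A = {} then 1 else 0)"
    using assms by auto
  ultimately show ?thesis by simp
qed

lemma minus_one_power_diff: "m \<le> n \<Longrightarrow> (-1 :: real) ^ (n - m) = (-1) ^ n * (-1) ^ m"
  by (metis (no_types) le_add_diff_inverse minus_one_power_iff power_add mult.right_neutral mult_minus1_right even_add)

context trace_alphabet
begin

subsection \<open>Moebius inversion on cliques\<close>

lemma moebius_transform_clique:
  assumes "indep_set D"
  shows "moebius_transform I f (clique D) =
         (\<Sum>E | indep_set E \<and> D \<subseteq> E. (-1) ^ (card E - card D) * f (clique E))"
proof -
  have "{c' \<in> cliques I. letters (clique D) \<subseteq> letters c'} = clique ` {E. indep_set E \<and> D \<subseteq> E}"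
    using assms by (auto simp: cliques_eq)
  moreover have "inj_on clique {E. indep_set E \<and> D \<subseteq> E}"
    by (auto simp: inj_on_def clique_eq_iff)
  ultimately show ?thesis
    unfolding moebius_transform_def using assms by (simp add: sum.reindex)
qed

lemma moebius_transform_one:
  "moebius_transform I f \<one>\<^bsub>trace_monoid I\<^esub> = (\<Sum>E | indep_set E. (-1) ^ card E * f (clique E))"
  using moebius_transform_clique[of "{}" f] by simp

text \<open>After exchanging the sums, the sets \<open>D\<close> belonging to a fixed
  \<open>E\<close> are the subsets of \<open>E \<inter> A\<close>, whose signs cancel unless this
  set is empty. The choices \<open>A = dep D\<close> and \<open>A = UNIV\<close> give
  \<open>g\<close> and the total mass of \<open>h\<close>.\<close>

lemma sum_moebius_transform:
  "(\<Sum>D | indep_set D \<and> D \<subseteq> A. moebius_transform I f (clique D)) =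
   (\<Sum>E | indep_set E \<and> E \<inter> A = {}. (-1) ^ card E * f (clique E))"
proof -
  have "(\<Sum>D | indep_set D \<and> D \<subseteq> A. moebius_transform I f (clique D)) =
    (\<Sum>D\<in>{D. indep_set D \<and> D \<subseteq> A}. \<Sum>E\<in>{E\<in>{E. indep_set E}. D \<subseteq> E}. (-1) ^ (card E - card D) * f (clique E))"
    by (intro sum.cong) (auto simp: moebius_transform_clique)
  also have "\<dots> = (\<Sum>E\<in>{E. indep_set E}. \<Sum>D\<in>{D\<in>{D. indep_set D \<and> D \<subseteq> A}. D \<subseteq> E}.
      (-1) ^ (card E - card D) * f (clique E))"
    by (rule sum.swap_restrict) auto
  also have "\<dots> = (\<Sum>E\<in>{E. indep_set E}. (-1) ^ card E * f (clique E) * (if E \<inter> A = {} then 1 else 0))"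
  proof (intro sum.cong HOL.refl)
    fix E assume "E \<in> {E. indep_set E}"
    then have E: "{D\<in>{D. indep_set D \<and> D \<subseteq> A}. D \<subseteq> E} = Pow (E \<inter> A)"
      using indep_set_mono by blast
    have "(\<Sum>D\<in>Pow (E \<inter> A). (-1) ^ (card E - card D) * f (clique E)) =
        (\<Sum>D\<in>Pow (E \<inter> A). (-1) ^ card E * f (clique E) * (-1) ^ card D)"
      by (intro sum.cong HOL.refl) (auto simp: minus_one_power_diff card_mono)
    also have "\<dots> = (-1) ^ card E * f (clique E) * (\<Sum>D\<in>Pow (E \<inter> A). (-1) ^ card D)"
      by (rule sum_distrib_left[symmetric])
    finally show "(\<Sum>D\<in>{D\<in>{D. indep_set D \<and> D \<subseteq> A}. D \<subseteq> E}. (-1) ^ (card E - card D) * f (clique E)) =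
        (-1) ^ card E * f (clique E) * (if E \<inter> A = {} then 1 else 0)"
      unfolding E by (subst (asm) sum_alternating_Pow) simp_all
  qed
  also have "\<dots> = (\<Sum>E | indep_set E \<and> E \<inter> A = {}. (-1) ^ card E * f (clique E))"
    by (intro sum.mono_neutral_cong_right) auto
  finally show ?thesis .
qed

lemma g_fun_clique:
  assumes "indep_set D"
  shows "g_fun I f (clique D) = (\<Sum>E | indep_set E \<and> E \<noteq> {} \<and> E \<subseteq> dep D. moebius_transform I f (clique E))"
proof -
  have "{c' \<in> ncliques I. clique_arrow I (clique D) c'} = clique ` {E. indep_set E \<and> E \<noteq> {} \<and> E \<subseteq> dep D}"
    using assms by (auto simp: ncliques_eq clique_arrow_clique)
  moreover have "inj_on clique {E. indep_set E \<and> E \<noteq> {} \<and> E \<subseteq> dep D}"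
    by (auto simp: inj_on_def clique_eq_iff)
  ultimately show ?thesis
    unfolding g_fun_def by (simp add: sum.reindex)
qed

text \<open>As the transform vanishes at the unit, the empty set may be added to the sum that
  defines \<open>g\<close>.\<close>

lemma g_fun_alternating:
  assumes "indep_set D" "moebius_transform I f \<one>\<^bsub>trace_monoid I\<^esub> = 0"
  shows "g_fun I f (clique D) = (\<Sum>E | indep_set E \<and> E \<inter> dep D = {}. (-1) ^ card E * f (clique E))"
proof -
  have "g_fun I f (clique D) = (\<Sum>E | indep_set E \<and> E \<subseteq> dep D. moebius_transform I f (clique E))"
    unfolding g_fun_clique[OF assms(1)] using assms(2)
    by (intro sum.mono_neutral_left) auto
  then show ?thesis by (simp add: sum_moebius_transform)
qed

lemma sum_moebius_ncliques:
  assumes "moebius_transform I f \<one>\<^bsub>trace_monoid I\<^esub> = 0"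
  shows "(\<Sum>c\<in>ncliques I. moebius_transform I f c) = f \<one>\<^bsub>trace_monoid I\<^esub>"
proof -
  have "inj_on clique {D. indep_set D \<and> D \<noteq> {}}"
    by (auto simp: inj_on_def clique_eq_iff)
  then have "(\<Sum>c\<in>ncliques I. moebius_transform I f c) =
      (\<Sum>D | indep_set D \<and> D \<noteq> {}. moebius_transform I f (clique D))"
    by (simp add: ncliques_eq sum.reindex)
  also have "\<dots> = (\<Sum>D | indep_set D \<and> D \<subseteq> UNIV. moebius_transform I f (clique D))"
    using assms by (intro sum.mono_neutral_left) auto
  also have "\<dots> = (\<Sum>E | E = {}. (-1) ^ card E * f (clique E))"
    unfolding sum_moebius_transform by (intro sum.cong) auto
  finally show ?thesis by simp
qed

subsection \<open>Inversion over traces of bounded height\<close>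

abbreviation tle (infix "\<preceq>" 50) where "x \<preceq> y \<equiv> x divides\<^bsub>trace_monoid I\<^esub> y"

lemma tle_refl [simp]: "x \<in> traces \<Longrightarrow> x \<preceq> x"
  by (rule tm.divides_refl)

lemma tle_mult: "x \<in> traces \<Longrightarrow> y \<in> traces \<Longrightarrow> z \<in> traces \<Longrightarrow> x \<preceq> y \<Longrightarrow> x \<preceq> y \<odot> z"
  by (rule tm.divides_prod_r)

lemma tleE:
  assumes "x \<preceq> y"
  obtains z where "z \<in> traces" "y = x \<odot> z"
  using assms by (auto simp: factor_def)

text \<open>Write \<open>w = x \<odot> z\<close>. By cancellation, the sets \<open>D\<close> are
  exactly the subsets of the maximal letters of \<open>z\<close>, and there are such letters unless
  \<open>z\<close> is the unit.\<close>

lemma sum_right_clique_divisors: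
  assumes "x \<in> traces" "w \<in> traces" "x \<preceq> w"
  shows "(\<Sum>D | indep_set D \<and> (\<exists>y\<in>traces. x \<preceq> y \<and> y \<odot> clique D = w). (-1) ^ card D) =
         (if w = x then 1 else 0 :: real)"
proof -
  obtain z where z: "z \<in> traces" "w = x \<odot> z" using assms(3) by (rule tleE)
  obtain v where v: "z = tr v" using z(1) by (rule traceE)
  have "{D. indep_set D \<and> (\<exists>y\<in>traces. x \<preceq> y \<and> y \<odot> clique D = w)} = Pow (rights v)"
  proof (intro equalityI subsetI)
    fix D assume "D \<in> {D. indep_set D \<and> (\<exists>y\<in>traces. x \<preceq> y \<and> y \<odot> clique D = w)}"
    then obtain y where D: "indep_set D" and y: "y \<in> traces" "x \<preceq> y" "y \<odot> clique D = w" by auto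
    obtain u' where u': "u' \<in> traces" "y = x \<odot> u'" using y(2) by (rule tleE)
    obtain u where u: "u' = tr u" using u'(1) by (rule traceE)
    obtain d where d: "distinct d" "set d = D" "clique D = tr d" using D by (rule clique_word)
    have "u' \<odot> clique D = z"
      using y u' z assms(1) by (simp add: tm.m_assoc tmult_cancel_left)
    then have "v \<simeq> u @ d" by (simp add: u d v trace_mult_trace_of trace_of_eq_iff cong_sym)
    then show "D \<in> Pow (rights v)"
      using subset_rights_if_cong[of d v u] d D by (simp add: indep_set_def)
  next
    fix D assume D: "D \<in> Pow (rights v)"
    then have ind: "indep_set D" using rights_clique unfolding indep_set_def by blast
    then obtain d where d: "distinct d" "set d = D" "clique D = tr d" by (rule clique_word)
    then obtain u where u: "v \<simeq> u @ d" using cong_if_subset_rights[of d v] D by auto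
    have "z = tr u \<odot> clique D"
      using u by (simp add: v d trace_mult_trace_of trace_of_eq_iff)
    then have "(x \<odot> tr u) \<odot> clique D = w"
      using assms z by (simp add: tm.m_assoc)
    moreover have "x \<odot> tr u \<in> traces" "x \<preceq> x \<odot> tr u" using assms(1) by (simp_all add: tle_mult)
    ultimately show "D \<in> {D. indep_set D \<and> (\<exists>y\<in>traces. x \<preceq> y \<and> y \<odot> clique D = w)}"
      using ind by blast
  qed
  moreover have "w = x \<longleftrightarrow> rights v = {}"
  proof -
    have "w = x \<longleftrightarrow> x \<odot> z = x \<odot> tr []" using assms(1) by (simp add: z flip: one_eq)
    also have "\<dots> \<longleftrightarrow> v = []" using assms(1) z(1) by (simp add: tmult_cancel_left v trace_of_eq_iff)
    finally show ?thesis by (simp add: rights_empty_iff)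
  qed
  ultimately show ?thesis by (simp add: sum_alternating_Pow)
qed

text \<open>Collect the terms by the value \<open>w\<close> of \<open>y \<odot> clique D\<close>;
  the coefficient of \<open>\<phi> w\<close> is then the alternating sum of
  \<open>sum_right_clique_divisors\<close>.\<close>

lemma bounded_height_inversion:
  fixes \<phi> :: "'a trace \<Rightarrow> real"
  assumes "x \<in> traces" "height I x \<le> n"
  shows "(\<Sum>y | y \<in> traces \<and> height I y \<le> n \<and> x \<preceq> y.
            \<Sum>D | indep_set D \<and> height I (y \<odot> clique D) \<le> n. (-1) ^ card D * \<phi> (y \<odot> clique D)) = \<phi> x"
proof -
  define T where "T = {y. y \<in> traces \<and> height I y \<le> n \<and> x \<preceq> y}"
  define L where "L y = {D. indep_set D \<and> height I (y \<odot> clique D) \<le> n}" for y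
  define R where "R w = {D. indep_set D \<and> (\<exists>y\<in>traces. x \<preceq> y \<and> y \<odot> clique D = w)}" for w
  have fin: "finite T" unfolding T_def by (rule finite_subset[OF _ finite_height_le[of n]]) auto
  \<comment> \<open>The height of \<open>y\<close> is at most that of
    \<open>y \<odot> clique D\<close>, so bounding the product is enough to recover the bound on
    \<open>y\<close>.\<close>
  have bij: "bij_betw (\<lambda>(y, D). (y \<odot> clique D, D)) (Sigma T L) (Sigma T R)"
    unfolding bij_betw_def
  proof
    show "inj_on (\<lambda>(y, D). (y \<odot> clique D, D)) (Sigma T L)"
      by (auto simp: inj_on_def T_def tmult_cancel_right)
    show "(\<lambda>(y, D). (y \<odot> clique D, D)) ` Sigma T L = Sigma T R"
    proof (intro equalityI subsetI)
      fix p assume "p \<in> (\<lambda>(y, D). (y \<odot> clique D, D)) ` Sigma T L"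
      then show "p \<in> Sigma T R"
        using assms(1) by (auto simp: T_def L_def R_def tle_mult)
    next
      fix p assume "p \<in> Sigma T R"
      then obtain w D y where p: "p = (w, D)" "w \<in> T" "indep_set D" "y \<in> traces" "x \<preceq> y" "y \<odot> clique D = w"
        by (auto simp: R_def)
      then have "height I y \<le> n" using height_le_mult[of y "clique D"] by (auto simp: T_def)
      then have "(y, D) \<in> Sigma T L" using p by (auto simp: T_def L_def)
      with p show "p \<in> (\<lambda>(y, D). (y \<odot> clique D, D)) ` Sigma T L" by force
    qed
  qed
  have "(\<Sum>y\<in>T. \<Sum>D\<in>L y. (-1) ^ card D * \<phi> (y \<odot> clique D)) =
      (\<Sum>(y, D)\<in>Sigma T L. (-1) ^ card D * \<phi> (y \<odot> clique D))"
    using fin by (intro sum.Sigma) auto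
  also have "\<dots> = (\<Sum>(w, D)\<in>Sigma T R. (-1) ^ card D * \<phi> w)"
    using sum.reindex_bij_betw[OF bij, of "\<lambda>(w, D). (-1) ^ card D * \<phi> w"]
    by (simp add: case_prod_unfold)
  also have "\<dots> = (\<Sum>w\<in>T. \<Sum>D\<in>R w. (-1) ^ card D * \<phi> w)"
    using fin by (intro sum.Sigma[symmetric]) auto
  also have "\<dots> = (\<Sum>w\<in>T. (if w = x then 1 else 0) * \<phi> w)"
    using assms(1) sum_right_clique_divisors[of x]
    by (intro sum.cong HOL.refl) (auto simp: T_def R_def simp flip: sum_distrib_right)
  also have "\<dots> = \<phi> x"
  proof -
    have "x \<in> T" using assms by (simp add: T_def)
    then show ?thesis using fin by (simp add: if_distrib[of "\<lambda>c. c * _"] sum.delta cong: if_cong)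
  qed
  finally show ?thesis by (simp add: T_def L_def)
qed

subsection \<open>Elementary cylinders\<close>

text \<open>The sets \<open>E\<close> of the overview. Lists that are not normal give the empty set,
  which therefore belongs to the family.\<close>

definition elem_cyl :: "'a trace list \<Rightarrow> (nat \<Rightarrow> 'a trace) set" where
  "elem_cyl cs = {\<xi> \<in> bdry I. map \<xi> [0..<length cs] = cs}"

text \<open>Indexes the decomposition of \<open>cyl\<close> of a normal form into elementary
  cylinders; its cardinality is the induction measure for uniqueness.\<close>

definition above :: "'a trace list \<Rightarrow> 'a trace list set" where
  "above cs = {ds. normal ds \<and> length ds = length cs \<and> trace_prod I cs \<preceq> trace_prod I ds}"

lemma normal_bdry: "\<xi> \<in> bdry I \<Longrightarrow> normal (map \<xi> [0..<n])"
proof (induction n)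
  case (Suc n)
  have "clique_arrow I (last (map \<xi> [0..<n])) (\<xi> n)" if "n > 0"
  proof -
    obtain m where "n = Suc m" using \<open>n > 0\<close> by (cases n) auto
    then show ?thesis using Suc.prems by (simp add: bdry_def)
  qed
  then show ?case using Suc by (auto simp: normal_snoc bdry_def)
qed simp

lemma bdry_if_normal: "(\<And>n. normal (map \<xi> [0..<n])) \<Longrightarrow> \<xi> \<in> bdry I"
proof -
  assume *: "\<And>n. normal (map \<xi> [0..<n])"
  have "\<xi> i \<in> ncliques I \<and> clique_arrow I (\<xi> i) (\<xi> (Suc i))" for i
    using *[of "Suc (Suc i)"] by (simp add: normal_def successively_append_iff)
  then show ?thesis by (simp add: bdry_def)
qed

lemma height_partial_prod: "\<xi> \<in> bdry I \<Longrightarrow> height I (partial_prod I \<xi> n) = n"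
  using height_prod[OF normal_bdry] by (simp add: partial_prod_def)

lemma partial_prod_in_traces [simp]: "\<xi> \<in> bdry I \<Longrightarrow> partial_prod I \<xi> n \<in> traces"
  using trace_prod_normal[OF normal_bdry] by (simp add: partial_prod_def)

text \<open>The partial product of \<open>n\<close> cliques has height \<open>n\<close>, so being
  below \<eta> in the sense of \<open>trace_le_bdry\<close> is literally the \<open>n\<close>-th
  condition of \<open>bdry_le\<close>.\<close>

lemma bdry_join_partial_prod:
  assumes "\<xi> \<in> bdry I"
  shows "bdry_join I (partial_prod I \<xi>) \<xi>"
  using assms unfolding bdry_join_def bdry_le_def trace_le_bdry_def
  by (simp add: height_partial_prod)

text \<open>Cancellation leaves \<open>u \<odot> v = \<one>\<close>, and only the empty word is
  congruent to the empty word.\<close>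

lemma tle_antisym:
  assumes "x \<in> traces" "x \<preceq> y" "y \<preceq> x"
  shows "x = y"
proof -
  obtain u where u: "u \<in> traces" "y = x \<odot> u" using assms(2) by (rule tleE)
  obtain v where v: "v \<in> traces" "x = y \<odot> v" using assms(3) by (rule tleE)
  have "x \<odot> (u \<odot> v) = (x \<odot> u) \<odot> v" using u(1) v(1) assms(1) by (simp only: tm.m_assoc)
  also have "\<dots> = x" by (simp only: u(2)[symmetric] v(2)[symmetric])
  also have "x = x \<odot> tr []" using assms(1) by (simp flip: one_eq)
  finally have "u \<odot> v = tr []" using u(1) v(1) assms(1) by (simp add: tmult_cancel_left)
  then have "u = \<one>\<^bsub>trace_monoid I\<^esub>"
    using u(1) v(1) by (elim traceE) (simp add: trace_mult_trace_of trace_of_eq_iff one_eq)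
  with u(2) assms(1) show ?thesis by simp
qed

lemma finite_above [simp]: "finite (above cs)"
  unfolding above_def by (rule finite_subset[OF _ finite_normal[of "length cs"]]) auto

lemma above_refl: "normal cs \<Longrightarrow> cs \<in> above cs"
  by (simp add: above_def)

text \<open>By antisymmetry and uniqueness of normal forms, \<open>cs\<close> itself is missing from
  \<open>above ds\<close>.\<close>

lemma above_psubset:
  assumes "normal cs" "ds \<in> above cs" "ds \<noteq> cs"
  shows "above ds \<subset> above cs"
proof
  have ds: "normal ds" "length ds = length cs" "trace_prod I cs \<preceq> trace_prod I ds"
    using assms(2) by (auto simp: above_def)
  show "above ds \<subseteq> above cs"
    using assms(1) ds by (auto simp: above_def intro: tm.divides_trans)
  have "cs \<notin> above ds"
    using ds assms(1,3) tle_antisym[of "trace_prod I cs" "trace_prod I ds"] normal_unique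
    by (auto simp: above_def)
  then show "above ds \<noteq> above cs" using above_refl[OF assms(1)] by blast
qed

lemma cyl_eq_Union:
  "cyl I x = (\<Union>cs\<in>{cs. normal cs \<and> length cs = height I x \<and> x \<preceq> trace_prod I cs}. elem_cyl cs)"
  (is "?L = ?R")
proof (intro equalityI subsetI)
  fix \<xi> assume \<xi>: "\<xi> \<in> ?L"
  then have "\<xi> \<in> bdry I" "x \<preceq> trace_prod I (map \<xi> [0..<height I x])"
    by (simp_all add: cyl_def trace_le_bdry_def partial_prod_def)
  then show "\<xi> \<in> ?R"
    using normal_bdry by (auto simp: elem_cyl_def intro!: exI[of _ "map \<xi> [0..<height I x]"])
next
  fix \<xi> assume "\<xi> \<in> ?R"
  then show "\<xi> \<in> ?L"
    by (auto simp: elem_cyl_def cyl_def trace_le_bdry_def partial_prod_def)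
qed

lemma cyl_prod_eq_Union: "normal cs \<Longrightarrow> cyl I (trace_prod I cs) = (\<Union>ds\<in>above cs. elem_cyl ds)"
  by (simp add: cyl_eq_Union above_def height_prod)

lemma elem_cyl_nil [simp]: "elem_cyl [] = bdry I"
  by (simp add: elem_cyl_def)

lemma elem_cyl_not_normal: "\<not> normal cs \<Longrightarrow> elem_cyl cs = {}"
  unfolding elem_cyl_def using normal_bdry[of _ "length cs"] by (metis (mono_tags, lifting) empty_Collect_eq)

lemma elem_cyl_disjoint: "length cs = length ds \<Longrightarrow> cs \<noteq> ds \<Longrightarrow> elem_cyl cs \<inter> elem_cyl ds = {}"
  by (auto simp: elem_cyl_def)

lemma elem_cyl_eq_Diff:
  assumes "normal cs"
  shows "elem_cyl cs = cyl I (trace_prod I cs) - (\<Union>ds\<in>above cs - {cs}. cyl I (trace_prod I ds))"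
proof -
  \<comment> \<open>A point of the second set starts with a member of \<open>above ds\<close>. Such
    a list has the length of \<open>cs\<close> but differs from it.\<close>
  have disj: "elem_cyl cs \<inter> cyl I (trace_prod I ds) = {}" if ds: "ds \<in> above cs" "ds \<noteq> cs" for ds
  proof -
    have "normal ds" "length ds = length cs" using ds by (auto simp: above_def)
    moreover have "cs \<notin> above ds"
      using above_psubset[OF assms ds] above_psubset[OF \<open>normal ds\<close>, of cs] ds(2) by blast
    ultimately have "elem_cyl cs \<inter> elem_cyl es = {}" if "es \<in> above ds" for es
      using that by (intro elem_cyl_disjoint) (auto simp: above_def)
    then show ?thesis unfolding cyl_prod_eq_Union[OF \<open>normal ds\<close>] by blast
  qed
  have sub: "elem_cyl ds \<subseteq> cyl I (trace_prod I ds)" if "ds \<in> above cs" for ds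
    using that cyl_prod_eq_Union[of ds] above_refl[of ds] by (auto simp: above_def)
  show ?thesis
  proof (intro equalityI subsetI)
    fix \<xi> assume "\<xi> \<in> elem_cyl cs"
    then show "\<xi> \<in> cyl I (trace_prod I cs) - (\<Union>ds\<in>above cs - {cs}. cyl I (trace_prod I ds))"
      using disj sub[OF above_refl[OF assms]] by auto
  next
    fix \<xi> assume "\<xi> \<in> cyl I (trace_prod I cs) - (\<Union>ds\<in>above cs - {cs}. cyl I (trace_prod I ds))"
    moreover from this obtain ds where "ds \<in> above cs" "\<xi> \<in> elem_cyl ds"
      using cyl_prod_eq_Union[OF assms] by auto
    ultimately show "\<xi> \<in> elem_cyl cs"
      using sub[of ds] by (cases "ds = cs") auto
  qed
qed

lemma cyl_subset: "cyl I x \<subseteq> bdry I"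
  by (auto simp: cyl_def)

lemma elem_cyl_subset: "elem_cyl cs \<subseteq> bdry I"
  by (auto simp: elem_cyl_def)

section \<open>The \<sigma>-algebra of the boundary and its generators\<close>

lemma space_bdry_algebra [simp]: "space (bdry_algebra I) = bdry I"
  using cyl_subset unfolding bdry_algebra_def by (intro space_measure_of) auto

lemma sets_bdry_algebra_cyl: "sets (bdry_algebra I) = sigma_sets (bdry I) (cyl I ` traces)"
  using cyl_subset unfolding bdry_algebra_def by (intro sets_measure_of) auto

lemma cyl_sets: "x \<in> traces \<Longrightarrow> cyl I x \<in> sets (bdry_algebra I)"
  by (auto simp: sets_bdry_algebra_cyl)

lemma elem_cyl_sets: "elem_cyl cs \<in> sets (bdry_algebra I)"
proof (cases "normal cs")
  case True
  have "normal ds" if "ds \<in> above cs" for ds using that by (simp add: above_def)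
  with True show ?thesis
    unfolding elem_cyl_eq_Diff[OF True]
    by (intro sets.Diff sets.finite_UN cyl_sets) auto
qed (simp add: elem_cyl_not_normal)

lemma sets_bdry_algebra: "sets (bdry_algebra I) = sigma_sets (bdry I) (range elem_cyl)"
proof
  have "cyl I x \<in> sigma_sets (bdry I) (range elem_cyl)" for x
    unfolding cyl_eq_Union
  proof (rule sigma_sets_UNION)
    show "countable (elem_cyl ` {cs. normal cs \<and> length cs = height I x \<and> x \<preceq> trace_prod I cs})"
      by (intro countable_image countable_finite finite_subset[OF _ finite_normal[of "height I x"]]) auto
  qed auto
  then show "sets (bdry_algebra I) \<subseteq> sigma_sets (bdry I) (range elem_cyl)"
    unfolding sets_bdry_algebra_cyl by (intro sigma_sets_mono) auto
  show "sigma_sets (bdry I) (range elem_cyl) \<subseteq> sets (bdry_algebra I)"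
    using sets.sigma_sets_subset[of "range elem_cyl" "bdry_algebra I"] elem_cyl_sets by auto
qed

text \<open>Either one list is a prefix of the other, and the intersection is the smaller cylinder,
  or the two cylinders are disjoint.\<close>

lemma Int_stable_elem_cyl: "Int_stable (range elem_cyl)"
proof (rule Int_stableI)
  \<comment> \<open>The unit is not a nonempty clique, so this list provides the empty set as a
    member of the family.\<close>
  have "\<not> normal [\<one>\<^bsub>trace_monoid I\<^esub>]" by (simp add: normal_def ncliques_def)
  then have empty: "{} \<in> range elem_cyl" using elem_cyl_not_normal by (metis rangeI)
  have *: "elem_cyl cs \<inter> elem_cyl ds \<in> range elem_cyl" if le: "length cs \<le> length ds" for cs ds
  proof (cases "take (length cs) ds = cs")
    case True
    have "map \<xi> [0..<length cs] = cs" if "map \<xi> [0..<length ds] = ds" for \<xi>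
      using True le that by (metis min_absorb1 take_map take_upt add_0)
    then have "elem_cyl cs \<inter> elem_cyl ds = elem_cyl ds" by (auto simp: elem_cyl_def)
    then show ?thesis by simp
  next
    case False
    have "map \<xi> [0..<length cs] = take (length cs) ds" if "map \<xi> [0..<length ds] = ds" for \<xi>
      using le that by (metis take_map take_upt add_0)
    then have "elem_cyl cs \<inter> elem_cyl ds = {}" using False by (auto simp: elem_cyl_def)
    then show ?thesis using empty by simp
  qed
  fix A B assume "A \<in> range elem_cyl" "B \<in> range elem_cyl"
  then obtain cs ds where "A = elem_cyl cs" "B = elem_cyl ds" by auto
  then show "A \<inter> B \<in> range elem_cyl"
    using *[of cs ds] *[of ds cs] by (cases "length cs \<le> length ds") (auto simp: Int_commute)
qed

lemma measure_cyl:
  assumes "finite_measure M" "sets M = sets (bdry_algebra I)"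
  shows "measure M (cyl I x) =
    (\<Sum>cs | normal cs \<and> length cs = height I x \<and> x \<preceq> trace_prod I cs. measure M (elem_cyl cs))"
proof -
  interpret finite_measure M by fact
  have "finite {cs. normal cs \<and> length cs = height I x \<and> x \<preceq> trace_prod I cs}"
    by (rule finite_subset[OF _ finite_normal[of "height I x"]]) auto
  moreover have "disjoint_family_on elem_cyl {cs. normal cs \<and> length cs = height I x \<and> x \<preceq> trace_prod I cs}"
    unfolding disjoint_family_on_def using elem_cyl_disjoint by auto
  ultimately show ?thesis
    unfolding cyl_eq_Union
    by (intro finite_measure_finite_Union) (auto simp: assms(2) elem_cyl_sets)
qed

text \<open>The mass of \<open>cyl\<close> of a normal form is that of its own elementary cylinder
  plus those of strictly larger traces of the same height. Induction on the number of traces above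
  thus recovers the masses on the generating \<open>\<pi>\<close>-system.\<close>

lemma measure_eqI_cyl:
  assumes M: "finite_measure M" "sets M = sets (bdry_algebra I)"
    and N: "finite_measure N" "sets N = sets (bdry_algebra I)"
    and eq: "\<And>x. x \<in> traces \<Longrightarrow> measure M (cyl I x) = measure N (cyl I x)"
  shows "M = N"
proof (rule measure_eqI_generator_eq[OF Int_stable_elem_cyl])
  interpret M: finite_measure M by fact
  interpret N: finite_measure N by fact
  have step: "measure M (elem_cyl cs) = measure N (elem_cyl cs)" if "normal cs" for cs
    using that
  proof (induction "card (above cs)" arbitrary: cs rule: less_induct)
    case less
    have sum: "measure L (cyl I (trace_prod I cs)) =
        measure L (elem_cyl cs) + (\<Sum>ds\<in>above cs - {cs}. measure L (elem_cyl ds))"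
      if "finite_measure L" "sets L = sets (bdry_algebra I)" for L
      using measure_cyl[OF that, of "trace_prod I cs"] sum.remove[OF finite_above above_refl, OF less.prems]
      by (simp add: height_prod less.prems flip: above_def)
    have "measure M (elem_cyl ds) = measure N (elem_cyl ds)" if "ds \<in> above cs - {cs}" for ds
    proof (rule less.hyps)
      show "card (above ds) < card (above cs)"
        using that above_psubset[OF less.prems, of ds] by (intro psubset_card_mono) auto
      show "normal ds" using that by (simp add: above_def)
    qed
    then have "(\<Sum>ds\<in>above cs - {cs}. measure M (elem_cyl ds)) = (\<Sum>ds\<in>above cs - {cs}. measure N (elem_cyl ds))"
      by (intro sum.cong) auto
    with sum[OF M] sum[OF N] eq less.prems show ?case by simp
  qed
  show "emeasure M X = emeasure N X" if "X \<in> range elem_cyl" for X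
  proof -
    from that obtain cs where X: "X = elem_cyl cs" by auto
    then have "measure M X = measure N X" using step elem_cyl_not_normal by (cases "normal cs") auto
    then show ?thesis by (simp add: M.emeasure_eq_measure N.emeasure_eq_measure)
  qed
  show "range (\<lambda>_::nat. bdry I) \<subseteq> range elem_cyl"
    using elem_cyl_nil by (metis image_subsetI rangeI)
  show "range elem_cyl \<subseteq> Pow (bdry I)" using elem_cyl_subset by auto
  show "sets M = sigma_sets (bdry I) (range elem_cyl)" "sets N = sigma_sets (bdry I) (range elem_cyl)"
    using M N by (simp_all add: sets_bdry_algebra)
  show "emeasure M (bdry I) \<noteq> \<infinity>" for i :: nat by simp
qed simp

end

subsection \<open>Moebius fibred valuations\<close>

locale moebius_valuation = trace_alphabet I for I :: "('a::finite \<times> 'a) set" +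
  fixes act :: "'x::finite \<Rightarrow> 'a trace \<Rightarrow> 'x" and f :: "'x \<Rightarrow> 'a trace \<Rightarrow> real"
  assumes right_action: "right_action I act"
    and moebius: "moebius_fibred_valuation I act f"
begin

abbreviation h :: "'x \<Rightarrow> 'a trace \<Rightarrow> real" where "h \<alpha> \<equiv> moebius_transform I (f \<alpha>)"

abbreviation g :: "'x \<Rightarrow> 'a trace \<Rightarrow> real" where "g \<alpha> \<equiv> g_fun I (f \<alpha>)"

lemma act_one [simp]: "act \<alpha> \<one>\<^bsub>trace_monoid I\<^esub> = \<alpha>"
  using right_action by (simp add: right_action_def)

lemma act_mult: "x \<in> traces \<Longrightarrow> y \<in> traces \<Longrightarrow> act \<alpha> (x \<odot> y) = act (act \<alpha> x) y"
  using right_action by (simp add: right_action_def)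

lemma f_one [simp]: "f \<alpha> \<one>\<^bsub>trace_monoid I\<^esub> = 1"
  using moebius by (simp add: moebius_fibred_valuation_def fibred_valuation_def)

lemma f_mult: "x \<in> traces \<Longrightarrow> y \<in> traces \<Longrightarrow> f \<alpha> (x \<odot> y) = f \<alpha> x * f (act \<alpha> x) y"
  using moebius by (simp add: moebius_fibred_valuation_def fibred_valuation_def)

lemma h_one [simp]: "h \<alpha> \<one>\<^bsub>trace_monoid I\<^esub> = 0"
  using moebius by (simp add: moebius_fibred_valuation_def)

lemma h_nonneg: "c \<in> ncliques I \<Longrightarrow> h \<alpha> c \<ge> 0"
  using moebius by (simp add: moebius_fibred_valuation_def)

lemma sum_h: "(\<Sum>c\<in>ncliques I. h \<alpha> c) = 1"
  by (simp add: sum_moebius_ncliques)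

lemma g_nonneg: "g \<alpha> c \<ge> 0"
  unfolding g_fun_def by (intro sum_nonneg) (auto simp: h_nonneg)

text \<open>A clique containing \<open>D\<close> is a product of \<open>clique D\<close> and a
  clique disjoint from \<open>dep D\<close>. The valuation splits off \<open>f \<alpha> c\<close>,
  and what remains is the alternating form of \<open>g\<close>.\<close>

lemma h_eq_f_times_g:
  assumes "c \<in> ncliques I"
  shows "h \<alpha> c = f \<alpha> c * g (act \<alpha> c) c"
proof -
  obtain D where D: "indep_set D" "c = clique D" using assms by (rule ncliqueE)
  have sub: "D \<subseteq> dep D" using indep_irrefl unfolding dep_def by blast
  have bij: "bij_betw ((\<union>) D) {E. indep_set E \<and> E \<inter> dep D = {}} {E. indep_set E \<and> D \<subseteq> E}"
  proof (rule bij_betw_byWitness[of _ "\<lambda>E. E - D"])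
    show "(\<union>) D ` {E. indep_set E \<and> E \<inter> dep D = {}} \<subseteq> {E. indep_set E \<and> D \<subseteq> E}"
    proof safe
      fix E assume E: "indep_set E" "E \<inter> dep D = {}"
      have "(a, b) \<in> I" if "a \<in> D" "b \<in> E" for a b using E(2) that by (auto simp: dep_def)
      then show "indep_set (D \<union> E)"
        using D(1) E(1) indep_sym unfolding indep_set_def by blast
    qed
    show "(\<lambda>E. E - D) ` {E. indep_set E \<and> D \<subseteq> E} \<subseteq> {E. indep_set E \<and> E \<inter> dep D = {}}"
    proof safe
      fix E b assume E: "indep_set E" "D \<subseteq> E" "b \<in> E" "b \<notin> D" "b \<in> dep D"
      then obtain a where "a \<in> D" "(a, b) \<notin> I" by (auto simp: dep_def)
      moreover have "a \<noteq> b" using \<open>a \<in> D\<close> E(4) by auto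
      ultimately show "b \<in> {}" using E(1-3) by (auto simp: indep_set_def)
    qed (auto intro: indep_set_mono)
  qed (use sub in auto)
  have "h \<alpha> c = (\<Sum>E | indep_set E \<and> E \<inter> dep D = {}. (-1) ^ (card (D \<union> E) - card D) * f \<alpha> (clique (D \<union> E)))"
    using sum.reindex_bij_betw[OF bij, of "\<lambda>E. (-1) ^ (card E - card D) * f \<alpha> (clique E)"] D
    by (simp add: moebius_transform_clique)
  also have "\<dots> = (\<Sum>E | indep_set E \<and> E \<inter> dep D = {}. f \<alpha> c * ((-1) ^ card E * f (act \<alpha> c) (clique E)))"
  proof (intro sum.cong HOL.refl)
    fix E assume E: "E \<in> {E. indep_set E \<and> E \<inter> dep D = {}}"
    then have "D \<inter> E = {}" using sub by auto
    moreover have "indep_set (D \<union> E)" using bij E unfolding bij_betw_def by blast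
    ultimately show "(-1) ^ (card (D \<union> E) - card D) * f \<alpha> (clique (D \<union> E)) =
        f \<alpha> c * ((-1) ^ card E * f (act \<alpha> c) (clique E))"
      by (simp add: card_Un_disjoint clique_union f_mult D)
  qed
  also have "\<dots> = f \<alpha> c * g (act \<alpha> c) c"
    using g_fun_alternating[OF D(1), of "f (act \<alpha> c)"] by (simp add: D sum_distrib_left)
  finally show ?thesis .
qed

text \<open>The mass intended for \<open>elem_cyl cs\<close>. Only nonempty lists are meant, as
  \<open>last []\<close> is unspecified.\<close>

definition weight :: "'x \<Rightarrow> 'a trace list \<Rightarrow> real" where
  "weight \<alpha> cs = f \<alpha> (trace_prod I (butlast cs)) * h (act \<alpha> (trace_prod I (butlast cs))) (last cs)"

lemma normal_split:
  assumes "normal cs" "cs \<noteq> []"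
  shows "normal (butlast cs)" "last cs \<in> ncliques I"
    and "trace_prod I cs = trace_prod I (butlast cs) \<odot> last cs"
proof -
  have cs: "cs = butlast cs @ [last cs]" using assms(2) by simp
  with assms(1) have "normal (butlast cs @ [last cs])" by simp
  then show *: "normal (butlast cs)" "last cs \<in> ncliques I" by (simp_all add: normal_snoc)
  show "trace_prod I cs = trace_prod I (butlast cs) \<odot> last cs"
    by (subst cs, rule trace_prod_snoc) (use * ncliques_subset normal_subset_traces in auto)
qed

text \<open>In this form the second factor is the denominator of the next transition, which makes
  the path probabilities telescope.\<close>

lemma weight_eq_f_times_g:
  assumes "normal cs" "cs \<noteq> []"
  shows "weight \<alpha> cs = f \<alpha> (trace_prod I cs) * g (act \<alpha> (trace_prod I cs)) (last cs)"
proof -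
  note cs = normal_split[OF assms]
  have "last cs \<in> traces" using cs(2) ncliques_subset by blast
  with cs show ?thesis by (simp add: weight_def h_eq_f_times_g f_mult act_mult)
qed

text \<open>A clique raises the height by at most one, so the bound excludes none of them and the
  sum is a multiple of the transform at the unit.\<close>

lemma alternating_sum_low:
  assumes "y \<in> traces" "height I y < n"
  shows "(\<Sum>D | indep_set D \<and> height I (y \<odot> clique D) \<le> n. (-1) ^ card D * f \<alpha> (y \<odot> clique D)) = 0"
proof -
  have "(\<Sum>D | indep_set D \<and> height I (y \<odot> clique D) \<le> n. (-1) ^ card D * f \<alpha> (y \<odot> clique D)) =
      (\<Sum>D | indep_set D. f \<alpha> y * ((-1) ^ card D * f (act \<alpha> y) (clique D)))"
  proof (intro sum.cong)
    show "{D. indep_set D \<and> height I (y \<odot> clique D) \<le> n} = {D. indep_set D}"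
      using height_mult_clique_le[OF assms(1)] assms(2) by (auto intro: order_trans Suc_leI)
  qed (simp add: f_mult assms)
  also have "\<dots> = f \<alpha> y * h (act \<alpha> y) \<one>\<^bsub>trace_monoid I\<^esub>"
    by (simp add: moebius_transform_one sum_distrib_left del: h_one)
  finally show ?thesis by simp
qed

text \<open>The bound now selects the cliques disjoint from \<open>dep C\<close>, where
  \<open>C\<close> is the set of letters of the last clique; these are the terms of the alternating
  form of \<open>g\<close>.\<close>

lemma alternating_sum_top:
  assumes "normal cs" "cs \<noteq> []"
  shows "(\<Sum>D | indep_set D \<and> height I (trace_prod I cs \<odot> clique D) \<le> length cs.
            (-1) ^ card D * f \<alpha> (trace_prod I cs \<odot> clique D)) = weight \<alpha> cs"
proof -
  define y where "y = trace_prod I cs"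
  obtain C where C: "indep_set C" "last cs = clique C"
    using normal_split(2)[OF assms] by (rule ncliqueE)
  have "(\<Sum>D | indep_set D \<and> height I (y \<odot> clique D) \<le> length cs. (-1) ^ card D * f \<alpha> (y \<odot> clique D)) =
      (\<Sum>D | indep_set D \<and> D \<inter> dep C = {}. f \<alpha> y * ((-1) ^ card D * f (act \<alpha> y) (clique D)))"
  proof (intro sum.cong)
    show "{D. indep_set D \<and> height I (y \<odot> clique D) \<le> length cs} = {D. indep_set D \<and> D \<inter> dep C = {}}"
      using height_mult_clique_iff[OF assms] C by (auto simp: y_def)
  qed (simp add: f_mult assms y_def)
  also have "\<dots> = f \<alpha> y * g (act \<alpha> y) (last cs)"
    using g_fun_alternating[OF C(1), of "f (act \<alpha> y)"] by (simp add: C sum_distrib_left)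
  finally show ?thesis by (simp add: weight_eq_f_times_g[OF assms] y_def)
qed

lemma sum_weight:
  assumes "x \<in> traces" "height I x = n" "n > 0"
  shows "(\<Sum>cs | normal cs \<and> length cs = n \<and> x \<preceq> trace_prod I cs. weight \<alpha> cs) = f \<alpha> x"
proof -
  let ?S = "\<lambda>y. \<Sum>D | indep_set D \<and> height I (y \<odot> clique D) \<le> n. (-1) ^ card D * f \<alpha> (y \<odot> clique D)"
  have "f \<alpha> x = (\<Sum>y | y \<in> traces \<and> height I y \<le> n \<and> x \<preceq> y. ?S y)"
    using bounded_height_inversion[OF assms(1), of n "f \<alpha>"] assms by simp
  also have "\<dots> = (\<Sum>y | y \<in> traces \<and> height I y = n \<and> x \<preceq> y. ?S y)"
  proof (rule sum.mono_neutral_right)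
    show "finite {y \<in> traces. height I y \<le> n \<and> x \<preceq> y}"
      by (rule finite_subset[OF _ finite_height_le[of n]]) auto
  qed (auto intro!: alternating_sum_low)
  also have "{y. y \<in> traces \<and> height I y = n \<and> x \<preceq> y} =
      trace_prod I ` {cs. normal cs \<and> length cs = n \<and> x \<preceq> trace_prod I cs}"
  proof (intro equalityI subsetI)
    fix y assume y: "y \<in> {y. y \<in> traces \<and> height I y = n \<and> x \<preceq> y}"
    then obtain cs where "normal cs" "trace_prod I cs = y" "length cs = height I y"
      using normal_form_exists by blast
    with y show "y \<in> trace_prod I ` {cs. normal cs \<and> length cs = n \<and> x \<preceq> trace_prod I cs}" by auto
  qed (auto simp: height_prod)
  also have "(\<Sum>y\<in>\<dots>. ?S y) =
      (\<Sum>cs | normal cs \<and> length cs = n \<and> x \<preceq> trace_prod I cs. ?S (trace_prod I cs))"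
    by (rule sum.reindex_cong[OF _ HOL.refl]) (auto simp: inj_on_def intro: normal_unique)
  also have "\<dots> = (\<Sum>cs | normal cs \<and> length cs = n \<and> x \<preceq> trace_prod I cs. weight \<alpha> cs)"
    using alternating_sum_top assms(3) by (intro sum.cong HOL.refl) fastforce
  finally show ?thesis ..
qed

end

subsection \<open>Existence of Markov chains on finite state spaces\<close>

text \<open>
  The chain is driven by independent choices \<open>\<omega> (n, s)\<close>, one for each time \<open>n\<close> and
  state \<open>s\<close>: the value at time \<open>n\<close> is \<open>\<omega> (n, s)\<close>, where \<open>s\<close> is the preceding state.
\<close>

lemma markov_chain_exists:
  fixes S :: "'s set" and \<nu> :: "'s \<Rightarrow> real" and q :: "'s \<Rightarrow> 's \<Rightarrow> real"
  assumes S: "finite S"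
    and \<nu>: "\<And>s. s \<in> S \<Longrightarrow> \<nu> s \<ge> 0" "sum \<nu> S = 1"
    and q: "\<And>s t. t \<in> S \<Longrightarrow> q s t \<ge> 0" "\<And>s. sum (q s) S = 1"
  obtains M :: "(nat \<times> 's \<Rightarrow> 's) measure" and Z
  where "prob_space M" "\<And>n. Z n \<in> measurable M (count_space S)"
    and "\<And>n z. (\<And>i. i \<le> n \<Longrightarrow> z i \<in> S) \<Longrightarrow>
           measure M {\<omega> \<in> space M. \<forall>i\<le>n. Z i \<omega> = z i} = \<nu> (z 0) * (\<Prod>i<n. q (z i) (z (Suc i)))"
proof -
  \<comment> \<open>At time \<open>0\<close> the row is \<open>\<nu>\<close> whatever the state; the
    fictitious predecessor there is \<open>undefined\<close>, below as well.\<close>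
  define \<kappa> where "\<kappa> n = (if n = 0 then (\<lambda>_. \<nu>) else q)" for n :: nat
  have \<kappa>: "\<kappa> n s t \<ge> 0" if "t \<in> S" for n s t using that \<nu>(1) q(1) by (simp add: \<kappa>_def)
  have \<kappa>_sum: "sum (\<kappa> n s) S = 1" for n s using \<nu>(2) q(2) by (simp add: \<kappa>_def)
  define N where "N j = point_measure S (\<lambda>t. ennreal (\<kappa> (fst j) (snd j) t))" for j :: "nat \<times> 's"
  have prob_N: "prob_space (N j)" for j
    unfolding N_def by (intro prob_spaceI)
      (simp add: space_point_measure emeasure_point_measure_finite S sum_ennreal \<kappa> \<kappa>_sum)
  have sets_N: "sets (N j) = sets (count_space S)" for j
    by (simp add: N_def sets_point_measure)
  interpret product_prob_space N UNIV
    by (intro product_prob_spaceI prob_N)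
  define M where "M = PiM UNIV N"
  define Z :: "nat \<Rightarrow> (nat \<times> 's \<Rightarrow> 's) \<Rightarrow> 's"
    where "Z = rec_nat (\<lambda>\<omega>. \<omega> (0, undefined)) (\<lambda>n Y \<omega>. \<omega> (Suc n, Y \<omega>))"
  have Z_0: "Z 0 \<omega> = \<omega> (0, undefined)" and Z_Suc: "Z (Suc n) \<omega> = \<omega> (Suc n, Z n \<omega>)" for n \<omega>
    by (simp_all add: Z_def)
  have component: "(\<lambda>\<omega>. \<omega> j) \<in> measurable M (count_space S)" for j
    using measurable_component_singleton[of j UNIV N] unfolding M_def
    by (simp cong: measurable_cong_sets add: measurable_cong_sets[OF HOL.refl sets_N])
  show thesis
  proof (rule that)
    show "prob_space M" unfolding M_def by (rule prob_space_PiM) (rule prob_N)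
    show "Z n \<in> measurable M (count_space S)" for n
    proof (induction n)
      case 0
      then show ?case using component[of "(0, undefined)"] by (simp add: Z_0[abs_def])
    next
      case (Suc n)
      show ?case unfolding Z_Suc[abs_def]
        by (rule measurable_compose_countable'[OF component Suc]) (simp add: S countable_finite)
    qed
    fix n and z :: "nat \<Rightarrow> 's"
    assume z: "\<And>i. i \<le> n \<Longrightarrow> z i \<in> S"
    define prev where "prev i = (case i of 0 \<Rightarrow> undefined | Suc k \<Rightarrow> z k)" for i
    let ?J = "(\<lambda>i. (i, prev i)) ` {..n}"
    \<comment> \<open>Following \<open>z\<close> constrains one coordinate for each time. These
      coordinates are distinct, so the product measure gives a product of row entries.\<close>
    have path: "(\<forall>i\<le>k. Z i \<omega> = z i) \<longleftrightarrow> (\<forall>i\<le>k. \<omega> (i, prev i) = z i)" for k \<omega>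
    proof (induction k)
      case 0
      then show ?case by (simp add: Z_0 prev_def)
    next
      case (Suc k)
      then show ?case by (auto simp: le_Suc_eq Z_Suc prev_def)
    qed
    have "{\<omega> \<in> space M. \<forall>i\<le>n. Z i \<omega> = z i} = {\<omega> \<in> space M. \<forall>j\<in>?J. \<omega> j \<in> {z (fst j)}}"
      by (auto simp: path)
    also have "emeasure M \<dots> = (\<Prod>j\<in>?J. emeasure (N j) {z (fst j)})"
      unfolding M_def using z by (intro emeasure_PiM_Collect) (auto simp: sets_N)
    also have "\<dots> = (\<Prod>i\<le>n. emeasure (N (i, prev i)) {z i})"
      by (subst prod.reindex) (auto simp: inj_on_def)
    also have "\<dots> = (\<Prod>i\<le>n. ennreal (\<kappa> i (prev i) (z i)))"
      using z by (intro prod.cong) (auto simp: N_def emeasure_point_measure_finite S)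
    also have "\<dots> = ennreal (\<Prod>i\<le>n. \<kappa> i (prev i) (z i))"
      using z by (intro prod_ennreal) (auto simp: \<kappa>)
    also have "(\<Prod>i\<le>n. \<kappa> i (prev i) (z i)) = \<nu> (z 0) * (\<Prod>i<n. q (z i) (z (Suc i)))"
      by (subst prod.atMost_shift) (simp add: \<kappa>_def prev_def)
    finally have "emeasure M {\<omega> \<in> space M. \<forall>i\<le>n. Z i \<omega> = z i} =
      ennreal (\<nu> (z 0) * (\<Prod>i<n. q (z i) (z (Suc i))))" .
    moreover have "\<nu> (z 0) * (\<Prod>i<n. q (z i) (z (Suc i))) \<ge> 0"
      using z by (intro mult_nonneg_nonneg prod_nonneg) (auto intro: \<nu> q)
    ultimately show "measure M {\<omega> \<in> space M. \<forall>i\<le>n. Z i \<omega> = z i} = \<nu> (z 0) * (\<Prod>i<n. q (z i) (z (Suc i)))"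
      by (simp add: measure_def)
  qed
qed

context moebius_valuation
begin

subsection \<open>The law of the chain\<close>

lemma weight_snoc:
  "weight \<alpha> (cs @ [c]) = f \<alpha> (trace_prod I cs) * h (act \<alpha> (trace_prod I cs)) c"
  by (simp add: weight_def)

text \<open>A single term of a sum of nonnegative terms; in particular, a vanishing denominator
  forces the numerators to vanish.\<close>

lemma h_le_g:
  assumes "c' \<in> ncliques I" "clique_arrow I c c'"
  shows "h \<beta> c' \<le> g \<beta> c"
  unfolding g_fun_def
  by (rule member_le_sum) (use assms in \<open>auto simp: h_nonneg\<close>)

text \<open>The cliques form a normal form and the states are transported by the action. All other
  paths have probability \<open>0\<close>.\<close>

definition consistent :: "'x \<Rightarrow> (nat \<Rightarrow> 'x \<times> 'a trace) \<Rightarrow> nat \<Rightarrow> bool" where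
  "consistent \<alpha> z n \<longleftrightarrow> normal (map (\<lambda>i. snd (z i)) [0..<Suc n]) \<and>
     (\<forall>i\<le>n. fst (z i) = act \<alpha> (trace_prod I (map (\<lambda>i. snd (z i)) [0..<i])))"

lemma path_sets:
  fixes n :: nat
  assumes "\<And>n. Z n \<in> measurable Q (count_space S)" "\<And>i. i \<le> n \<Longrightarrow> z i \<in> S"
  shows "{\<omega> \<in> space Q. \<forall>i\<le>n. Z i \<omega> = z i} \<in> sets Q"
proof -
  have "{\<omega> \<in> space Q. \<forall>i\<le>n. Z i \<omega> = z i} = (\<Inter>i\<in>{..n}. Z i -` {z i} \<inter> space Q)"
    by auto
  also have "\<dots> \<in> sets Q"
    using assms by (intro sets.finite_INT) (auto intro!: measurable_sets[OF assms(1)])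
  finally show ?thesis .
qed

text \<open>
  The kernel \<open>q\<close> may differ from \<open>transition\<close> on the zero rows of the latter: those states
  are visited with probability \<open>0\<close>.
\<close>

lemma path_prob:
  assumes Q: "prob_space Q"
    and Z: "\<And>n. Z n \<in> measurable Q (count_space (UNIV \<times> ncliques I))"
    and init: "\<And>s. s \<in> UNIV \<times> ncliques I \<Longrightarrow> measure Q {\<omega> \<in> space Q. Z 0 \<omega> = s} = initial_law I f \<alpha> s"
    and step: "\<And>n z. (\<And>i. i \<le> Suc n \<Longrightarrow> z i \<in> UNIV \<times> ncliques I) \<Longrightarrow>
        measure Q {\<omega> \<in> space Q. \<forall>i\<le>n. Z i \<omega> = z i} > 0 \<Longrightarrow>
        measure Q {\<omega> \<in> space Q. \<forall>i\<le>Suc n. Z i \<omega> = z i} =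
        measure Q {\<omega> \<in> space Q. \<forall>i\<le>n. Z i \<omega> = z i} * q (z n) (z (Suc n))"
    and q: "\<And>s t. g (act (fst s) (snd s)) (snd s) \<noteq> 0 \<Longrightarrow> q s t = transition I act f s t"
    and z: "\<And>i. i \<le> n \<Longrightarrow> z i \<in> UNIV \<times> ncliques I"
  shows "measure Q {\<omega> \<in> space Q. \<forall>i\<le>n. Z i \<omega> = z i} =
     (if consistent \<alpha> z n then weight \<alpha> (map (\<lambda>i. snd (z i)) [0..<Suc n]) else 0)"
  using z
proof (induction n)
  case 0
  have z0: "z 0 \<in> UNIV \<times> ncliques I" using 0 by simp
  have "consistent \<alpha> z 0 \<longleftrightarrow> fst (z 0) = \<alpha>"
    using z0 normal_snoc[of "[]" "snd (z 0)"] by (auto simp: consistent_def)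
  moreover have "weight \<alpha> (map (\<lambda>i. snd (z i)) [0..<Suc 0]) = h \<alpha> (snd (z 0))"
    using weight_snoc[of \<alpha> "[]"] by simp
  ultimately show ?case using init[OF z0] by (simp add: initial_law_def case_prod_unfold)
next
  case (Suc n)
  interpret Q: prob_space Q by fact
  let ?cs = "map (\<lambda>i. snd (z i)) [0..<n]"
  let ?c = "snd (z n)" and ?c' = "snd (z (Suc n))"
  let ?H = "\<lambda>n. {\<omega> \<in> space Q. \<forall>i\<le>n. Z i \<omega> = z i}"
  define x where "x = trace_prod I (?cs @ [?c])"
  have zn: "z i \<in> UNIV \<times> ncliques I" if "i \<le> n" for i using that Suc.prems by simp
  have c': "?c' \<in> ncliques I" using Suc.prems[of "Suc n"] by auto
  have IH: "measure Q (?H n) = (if consistent \<alpha> z n then weight \<alpha> (?cs @ [?c]) else 0)"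
    using Suc.IH[OF zn] by simp
  have cons: "consistent \<alpha> z (Suc n) \<longleftrightarrow>
      consistent \<alpha> z n \<and> clique_arrow I ?c ?c' \<and> fst (z (Suc n)) = act \<alpha> x"
  proof -
    have "normal ((?cs @ [?c]) @ [?c']) \<longleftrightarrow> normal (?cs @ [?c]) \<and> clique_arrow I ?c ?c'"
      using c' by (subst normal_snoc) simp
    then show ?thesis by (auto simp: consistent_def le_Suc_eq x_def)
  qed
  have weight_x: "weight \<alpha> (?cs @ [?c]) = f \<alpha> x * g (act \<alpha> x) ?c" if "consistent \<alpha> z n"
    using that weight_eq_f_times_g[of "?cs @ [?c]" \<alpha>] by (simp add: consistent_def x_def)
  have act_x: "act (fst (z n)) ?c = act \<alpha> x" if "consistent \<alpha> z n"
  proof -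
    have "normal (?cs @ [?c])" "fst (z n) = act \<alpha> (trace_prod I ?cs)"
      using that by (auto simp: consistent_def)
    then show ?thesis
      using ncliques_subset trace_prod_normal[of ?cs]
      by (auto simp: x_def normal_snoc normal_split(3) act_mult)
  qed
  have "map (\<lambda>i. snd (z i)) [0..<Suc (Suc n)] = (?cs @ [?c]) @ [?c']" by simp
  then have weight': "weight \<alpha> (map (\<lambda>i. snd (z i)) [0..<Suc (Suc n)]) = f \<alpha> x * h (act \<alpha> x) ?c'"
    by (simp only: weight_snoc x_def)
  show ?case
  proof (cases "measure Q (?H n) > 0")
    case True
    then have n: "consistent \<alpha> z n" using IH by (auto split: if_splits)
    \<comment> \<open>The prefix has positive mass, so the denominator is nonzero and will cancel
      against the factor \<open>g (act \<alpha> x) ?c\<close> of that mass.\<close>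
    with True IH weight_x have "f \<alpha> x * g (act \<alpha> x) ?c > 0" by simp
    then have ne: "f \<alpha> x \<noteq> 0" "g (act \<alpha> x) ?c \<noteq> 0" by auto
    have "measure Q (?H (Suc n)) = f \<alpha> x * g (act \<alpha> x) ?c * transition I act f (z n) (z (Suc n))"
      using step[of n z, OF _ True] Suc.prems IH n weight_x[OF n] q[of "z n" "z (Suc n)"] act_x[OF n] ne by simp
    also have "transition I act f (z n) (z (Suc n)) =
        (if clique_arrow I ?c ?c' \<and> fst (z (Suc n)) = act \<alpha> x then h (act \<alpha> x) ?c' / g (act \<alpha> x) ?c else 0)"
      using ne act_x[OF n] by (auto simp: transition_def case_prod_unfold)
    finally show ?thesis using ne n weight' cons by auto
  next
    case False
    then have zero: "measure Q (?H n) = 0" by (simp add: zero_less_measure_iff)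
    have "measure Q (?H (Suc n)) \<le> measure Q (?H n)"
    proof (rule Q.finite_measure_mono)
      show "?H n \<in> sets Q" by (rule path_sets[OF Z]) (rule zn)
    qed auto
    then have "measure Q (?H (Suc n)) = 0" using zero by (simp add: measure_le_0_iff)
    \<comment> \<open>The prefix has mass \<open>0\<close>, so \<open>f\<close> or \<open>g\<close>
      vanishes; in the latter case \<open>h\<close> vanishes too, being between \<open>0\<close> and
      \<open>g\<close>.\<close>
    moreover have "f \<alpha> x * h (act \<alpha> x) ?c' = 0" if "consistent \<alpha> z (Suc n)"
    proof (cases "f \<alpha> x = 0")
      case False
      then have "g (act \<alpha> x) ?c = 0" using that cons IH weight_x zero by simp
      then have "h (act \<alpha> x) ?c' \<le> 0" using h_le_g[OF c', of ?c "act \<alpha> x"] that cons by simp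
      then show ?thesis using h_nonneg[OF c', of "act \<alpha> x"] by simp
    qed simp
    ultimately show ?thesis using weight' by simp
  qed
qed

text \<open>Sum over all sequences of states. The action determines the states from \<alpha> and the
  cliques, so at most one sequence contributes.\<close>

lemma clique_path_prob:
  assumes Q: "prob_space Q"
    and Z: "\<And>n. Z n \<in> measurable Q (count_space (UNIV \<times> ncliques I))"
    and path: "\<And>n z. (\<And>i. i \<le> n \<Longrightarrow> z i \<in> UNIV \<times> ncliques I) \<Longrightarrow>
      measure Q {\<omega> \<in> space Q. \<forall>i\<le>n. Z i \<omega> = z i} =
      (if consistent \<alpha> z n then weight \<alpha> (map (\<lambda>i. snd (z i)) [0..<Suc n]) else 0)"
    and cs: "set cs \<subseteq> ncliques I" "cs \<noteq> []"
  shows "measure Q {\<omega> \<in> space Q. map (\<lambda>i. snd (Z i \<omega>)) [0..<length cs] = cs} =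
     (if normal cs then weight \<alpha> cs else 0)"
proof -
  interpret Q: prob_space Q by fact
  obtain n where n: "length cs = Suc n" using cs(2) by (cases cs) auto
  \<comment> \<open>Functions are made extensional outside \<open>{..n}\<close> so that there are
    finitely many of them and each event is counted once.\<close>
  define B where "B = PiE {..n} (\<lambda>_. UNIV :: 'x set)"
  define H where "H \<beta> = {\<omega> \<in> space Q. \<forall>i\<le>n. Z i \<omega> = (\<beta> i, cs ! i)}" for \<beta> :: "nat \<Rightarrow> 'x"
  define \<beta>0 where "\<beta>0 = (\<lambda>i\<in>{..n}. act \<alpha> (trace_prod I (take i cs)))"
  have in_S: "(\<beta> i, cs ! i) \<in> UNIV \<times> ncliques I" if "i \<le> n" for i and \<beta> :: "nat \<Rightarrow> 'x"
    using that cs(1) n by (auto intro: nth_mem)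
  have prefix: "map (\<lambda>i. cs ! i) [0..<k] = take k cs" if "k \<le> Suc n" for k
    using that n by (intro nth_equalityI) auto
  have eq: "{\<omega> \<in> space Q. map (\<lambda>i. snd (Z i \<omega>)) [0..<length cs] = cs} = (\<Union>\<beta>\<in>B. H \<beta>)"
  proof (intro equalityI subsetI)
    fix \<omega> assume \<omega>: "\<omega> \<in> {\<omega> \<in> space Q. map (\<lambda>i. snd (Z i \<omega>)) [0..<length cs] = cs}"
    then have "snd (Z i \<omega>) = cs ! i" if "i \<le> n" for i
      using that n by (metis (mono_tags, lifting) add_0 diff_zero le_imp_less_Suc length_upt mem_Collect_eq nth_map nth_upt)
    then have "\<omega> \<in> H (\<lambda>i\<in>{..n}. fst (Z i \<omega>))" using \<omega> by (auto simp: H_def prod_eq_iff)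
    moreover have "(\<lambda>i\<in>{..n}. fst (Z i \<omega>)) \<in> B" by (simp add: B_def)
    ultimately show "\<omega> \<in> (\<Union>\<beta>\<in>B. H \<beta>)" by blast
  next
    fix \<omega> assume "\<omega> \<in> (\<Union>\<beta>\<in>B. H \<beta>)"
    then have "\<omega> \<in> space Q" "\<And>i. i \<le> n \<Longrightarrow> snd (Z i \<omega>) = cs ! i" by (auto simp: H_def)
    moreover from this(2) have "map (\<lambda>i. snd (Z i \<omega>)) [0..<length cs] = cs"
      by (intro nth_equalityI) (simp_all add: n less_Suc_eq_le del: upt_Suc)
    ultimately show "\<omega> \<in> {\<omega> \<in> space Q. map (\<lambda>i. snd (Z i \<omega>)) [0..<length cs] = cs}" by simp
  qed
  have disj: "disjoint_family_on H B"
    unfolding disjoint_family_on_def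
  proof (intro ballI impI)
    fix \<beta> \<gamma> assume "\<beta> \<in> B" "\<gamma> \<in> B" "\<beta> \<noteq> \<gamma>"
    then obtain i where "i \<le> n" "\<beta> i \<noteq> \<gamma> i"
      by (metis B_def PiE_ext atMost_iff)
    then show "H \<beta> \<inter> H \<gamma> = {}" by (auto simp: H_def)
  qed
  have "measure Q (\<Union>\<beta>\<in>B. H \<beta>) = (\<Sum>\<beta>\<in>B. measure Q (H \<beta>))"
  proof (rule Q.finite_measure_finite_Union[OF _ _ disj])
    show "finite B" unfolding B_def by (intro finite_PiE) auto
    show "H ` B \<subseteq> sets Q"
    proof safe
      fix \<beta> show "H \<beta> \<in> sets Q" unfolding H_def by (rule path_sets[OF Z]) (rule in_S)
    qed
  qed
  also have "\<dots> = (\<Sum>\<beta>\<in>B. if \<beta> = \<beta>0 then (if normal cs then weight \<alpha> cs else 0) else 0)"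
  proof (intro sum.cong HOL.refl)
    fix \<beta> assume \<beta>: "\<beta> \<in> B"
    have "map (\<lambda>i. snd (\<beta> i, cs ! i)) [0..<Suc n] = cs" using prefix[of "Suc n"] n by simp
    moreover have "consistent \<alpha> (\<lambda>i. (\<beta> i, cs ! i)) n \<longleftrightarrow> normal cs \<and> \<beta> = \<beta>0"
    proof -
      have "\<beta> = \<beta>0 \<longleftrightarrow> (\<forall>i\<le>n. \<beta> i = act \<alpha> (trace_prod I (take i cs)))"
      proof
        assume *: "\<forall>i\<le>n. \<beta> i = act \<alpha> (trace_prod I (take i cs))"
        show "\<beta> = \<beta>0"
          by (rule PiE_ext[OF \<beta>[unfolded B_def]]) (auto simp: \<beta>0_def *)
      qed (simp add: \<beta>0_def)
      then show ?thesis using prefix n by (auto simp: consistent_def simp del: upt_Suc)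
    qed
    ultimately show "measure Q (H \<beta>) = (if \<beta> = \<beta>0 then (if normal cs then weight \<alpha> cs else 0) else 0)"
      using path[of n "\<lambda>i. (\<beta> i, cs ! i)"] in_S[of _ \<beta>] by (simp add: H_def)
  qed
  also have "\<dots> = (if normal cs then weight \<alpha> cs else 0)"
  proof -
    have "finite B" "\<beta>0 \<in> B" unfolding B_def \<beta>0_def by (auto intro: finite_PiE)
    then show ?thesis by simp
  qed
  finally show ?thesis by (simp add: eq)
qed

text \<open>There are countably many finite lists of cliques, and those that are not normal have
  mass \<open>0\<close> as prefixes. Off their union the sequence is in the boundary, and the masses
  of its prefixes add up to \<open>f\<close> on the sets \<open>cyl\<close>.\<close>

lemma law_on_bdry:
  fixes X :: "nat \<Rightarrow> 'w \<Rightarrow> 'a trace"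
  assumes Q: "prob_space Q"
    and X: "\<And>i. X i \<in> measurable Q (count_space (ncliques I))"
    and law: "\<And>cs. set cs \<subseteq> ncliques I \<Longrightarrow> cs \<noteq> [] \<Longrightarrow>
      measure Q {\<omega> \<in> space Q. map (\<lambda>i. X i \<omega>) [0..<length cs] = cs} = (if normal cs then weight \<alpha> cs else 0)"
  defines "\<xi> \<equiv> \<lambda>\<omega> i. X i \<omega>"
  shows "AE \<omega> in Q. \<xi> \<omega> \<in> bdry I"
    and "\<exists>R. prob_space R \<and> sets R = sets (bdry_algebra I) \<and>
      (\<forall>x\<in>traces. measure R (cyl I x) = f \<alpha> x) \<and>
      (\<forall>A\<in>sets (bdry_algebra I). \<xi> -` A \<inter> space Q \<in> sets Q \<and> emeasure R A = emeasure Q (\<xi> -` A \<inter> space Q))"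
proof -
  interpret Q: prob_space Q by fact
  define pre where "pre cs = {\<omega> \<in> space Q. map (\<xi> \<omega>) [0..<length cs] = cs}" for cs
  define B where "B = {\<omega> \<in> space Q. \<xi> \<omega> \<in> bdry I}"
  have X_in: "\<xi> \<omega> i \<in> ncliques I" if "\<omega> \<in> space Q" for \<omega> i
    using measurable_space[OF X that] by (simp add: \<xi>_def)
  have pre_sets: "pre cs \<in> sets Q" for cs
  proof (cases "set cs \<subseteq> ncliques I")
    case True
    have *: "map (\<xi> \<omega>) [0..<length cs] = cs \<longleftrightarrow> (\<forall>i\<in>{..<length cs}. X i \<omega> = cs ! i)" for \<omega>
      unfolding list_eq_iff_nth_eq \<xi>_def by (simp add: Ball_def)
    have "{\<omega> \<in> space Q. X i \<omega> = cs ! i} \<in> sets Q" if "i < length cs" for i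
    proof -
      have "cs ! i \<in> ncliques I" using True that by auto
      then have "X i -` {cs ! i} \<inter> space Q \<in> sets Q" by (intro measurable_sets[OF X]) simp
      then show ?thesis by (simp add: vimage_def Int_def conj_commute)
    qed
    then show ?thesis
      unfolding pre_def * by (intro sets.sets_Collect_finite_All) auto
  next
    case False
    have "set (map (\<xi> \<omega>) [0..<length cs]) \<subseteq> ncliques I" if "\<omega> \<in> space Q" for \<omega>
      using X_in[OF that] by auto
    with False have "pre cs = {}" unfolding pre_def by (metis (mono_tags, lifting) empty_Collect_eq)
    then show ?thesis by simp
  qed
  define N where "N = (\<Union>cs\<in>{cs. set cs \<subseteq> ncliques I \<and> \<not> normal cs}. pre cs)"
  have "N \<in> null_sets Q" unfolding N_def
  proof (rule null_sets_UN')
    show "countable {cs. set cs \<subseteq> ncliques I \<and> \<not> normal cs}"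
      by (rule countable_subset[OF _ countable_lists[OF countable_finite[OF finite_ncliques]]]) auto
    fix cs assume "cs \<in> {cs. set cs \<subseteq> ncliques I \<and> \<not> normal cs}"
    moreover from this have "cs \<noteq> []" by auto
    ultimately have "measure Q (pre cs) = 0" using law[of cs] by (simp add: pre_def \<xi>_def)
    then show "pre cs \<in> null_sets Q" using pre_sets[of cs] by (simp add: null_sets_def Q.emeasure_eq_measure)
  qed
  have B_eq: "B = space Q - N"
  proof (intro equalityI subsetI)
    fix \<omega> assume "\<omega> \<in> B"
    then have \<omega>: "\<omega> \<in> space Q" "\<xi> \<omega> \<in> bdry I" by (auto simp: B_def)
    have "\<omega> \<notin> pre cs" if "\<not> normal cs" for cs
      using that normal_bdry[OF \<omega>(2), of "length cs"] by (auto simp: pre_def)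
    with \<omega> show "\<omega> \<in> space Q - N" by (auto simp: N_def)
  next
    fix \<omega> assume \<omega>: "\<omega> \<in> space Q - N"
    have "normal (map (\<xi> \<omega>) [0..<n])" for n
    proof (rule ccontr)
      assume "\<not> normal (map (\<xi> \<omega>) [0..<n])"
      moreover have "\<omega> \<in> pre (map (\<xi> \<omega>) [0..<n])" using \<omega> by (simp add: pre_def)
      moreover have "set (map (\<xi> \<omega>) [0..<n]) \<subseteq> ncliques I" using X_in \<omega> by auto
      ultimately show False using \<omega> unfolding N_def by blast
    qed
    then show "\<omega> \<in> B" using \<omega> bdry_if_normal by (auto simp: B_def)
  qed
  have B_sets: "B \<in> sets Q" using \<open>N \<in> null_sets Q\<close> by (auto simp: B_eq)
  show AE: "AE \<omega> in Q. \<xi> \<omega> \<in> bdry I"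
    by (rule AE_I'[OF \<open>N \<in> null_sets Q\<close>]) (use B_eq in \<open>auto simp: B_def\<close>)
  have B_prob: "emeasure Q B = 1"
    using AE B_sets by (subst Q.emeasure_eq_1_AE) (auto simp: B_def)
  \<comment> \<open>Only on \<open>B\<close> does \<xi> take values in the space of
    \<open>bdry_algebra I\<close>, so the image measure is formed after restriction to this event of
    full mass.\<close>
  let ?Q = "restrict_space Q B"
  have space_Q: "space ?Q = B" using B_sets sets.sets_into_space by (auto simp: space_restrict_space)
  have \<xi>_meas: "\<xi> \<in> measurable ?Q (bdry_algebra I)"
  proof (rule measurable_sigma_sets[OF sets_bdry_algebra])
    fix A assume "A \<in> range elem_cyl"
    then obtain cs where "A = elem_cyl cs" by auto
    then have "\<xi> -` A \<inter> space ?Q = pre cs \<inter> B" unfolding space_Q by (auto simp: B_def pre_def elem_cyl_def)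
    then show "\<xi> -` A \<inter> space ?Q \<in> sets ?Q"
      using pre_sets[of cs] B_sets by (simp add: sets_restrict_space_iff)
  qed (use elem_cyl_subset space_Q in \<open>auto simp: B_def\<close>)
  define R where "R = distr ?Q (bdry_algebra I) \<xi>"
  have sets_R: "sets R = sets (bdry_algebra I)" by (simp add: R_def)
  have R: "\<xi> -` A \<inter> space Q \<in> sets Q \<and> emeasure R A = emeasure Q (\<xi> -` A \<inter> space Q)"
    if A: "A \<in> sets (bdry_algebra I)" for A
  proof -
    have "A \<subseteq> bdry I" using sets.sets_into_space[OF A] by simp
    then have eq: "\<xi> -` A \<inter> space ?Q = \<xi> -` A \<inter> space Q" unfolding space_Q by (auto simp: B_def)
    have "\<xi> -` A \<inter> space Q \<in> sets ?Q" using measurable_sets[OF \<xi>_meas A] unfolding eq .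
    then have "\<xi> -` A \<inter> space Q \<in> sets Q" "\<xi> -` A \<inter> space Q \<subseteq> B"
      using B_sets by (simp_all add: sets_restrict_space_iff)
    moreover have "emeasure R A = emeasure Q (\<xi> -` A \<inter> space Q)"
      unfolding R_def emeasure_distr[OF \<xi>_meas A] eq
      using B_sets calculation by (intro emeasure_restrict_space) auto
    ultimately show ?thesis by simp
  qed
  have prob_R: "prob_space R"
  proof
    have "emeasure R (bdry I) = emeasure Q (\<xi> -` bdry I \<inter> space Q)"
      using R[of "bdry I"] elem_cyl_sets[of "[]"] by simp
    also have "\<xi> -` bdry I \<inter> space Q = B" by (auto simp: B_def)
    finally show "emeasure R (space R) = 1" using B_prob by (simp add: R_def)
  qed
  interpret R: prob_space R by fact
  have R_elem: "measure R (elem_cyl cs) = weight \<alpha> cs" if cs: "normal cs" "cs \<noteq> []" for cs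
  proof -
    have "\<xi> -` elem_cyl cs \<inter> space Q = pre cs \<inter> B" by (auto simp: B_def pre_def elem_cyl_def)
    then have "emeasure R (elem_cyl cs) = emeasure Q (pre cs \<inter> B)"
      using R[OF elem_cyl_sets] by simp
    also have "\<dots> = emeasure Q (pre cs)"
      using AE pre_sets[of cs] B_sets by (intro emeasure_eq_AE) (auto simp: B_def pre_def)
    finally have "measure R (elem_cyl cs) = measure Q (pre cs)" by (simp add: measure_def)
    also have "\<dots> = weight \<alpha> cs"
      using law[of cs] cs by (simp add: pre_def \<xi>_def normal_def)
    finally show ?thesis .
  qed
  have "measure R (cyl I x) = f \<alpha> x" if x: "x \<in> traces" for x
  \<comment> \<open>\<open>sum_weight\<close> concerns positive heights. At height \<open>0\<close>
    the trace is the unit, whose cylinder is the whole boundary.\<close>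
  proof (cases "height I x = 0")
    case True
    obtain cs where cs: "normal cs" "trace_prod I cs = x" "length cs = height I x"
      using x by (rule normal_form_exists)
    then have x1: "x = \<one>\<^bsub>trace_monoid I\<^esub>" using True by simp
    then have "cyl I x = space R"
      using tle_refl[of "\<one>\<^bsub>trace_monoid I\<^esub>"] True
      by (auto simp: R_def cyl_def trace_le_bdry_def partial_prod_def)
    then show ?thesis using R.prob_space by (simp add: x1)
  next
    case False
    have "measure R (cyl I x) =
        (\<Sum>cs | normal cs \<and> length cs = height I x \<and> x \<preceq> trace_prod I cs. measure R (elem_cyl cs))"
      by (rule measure_cyl) (simp_all add: sets_R R.finite_measure_axioms)
    also have "\<dots> = (\<Sum>cs | normal cs \<and> length cs = height I x \<and> x \<preceq> trace_prod I cs. weight \<alpha> cs)"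
      using False by (intro sum.cong HOL.refl) (auto intro!: R_elem)
    also have "\<dots> = f \<alpha> x" using False x by (intro sum_weight) auto
    finally show ?thesis .
  qed
  with prob_R sets_R R show "\<exists>R. prob_space R \<and> sets R = sets (bdry_algebra I) \<and>
      (\<forall>x\<in>traces. measure R (cyl I x) = f \<alpha> x) \<and>
      (\<forall>A\<in>sets (bdry_algebra I). \<xi> -` A \<inter> space Q \<in> sets Q \<and> emeasure R A = emeasure Q (\<xi> -` A \<inter> space Q))"
    by blast
qed

lemma markov_chain_path_prob:
  assumes "markov_chain Q (UNIV \<times> ncliques I) (initial_law I f \<alpha>) (transition I act f) Z"
    and "\<And>i. i \<le> n \<Longrightarrow> z i \<in> UNIV \<times> ncliques I"
  shows "measure Q {\<omega> \<in> space Q. \<forall>i\<le>n. Z i \<omega> = z i} =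
     (if consistent \<alpha> z n then weight \<alpha> (map (\<lambda>i. snd (z i)) [0..<Suc n]) else 0)"
proof (rule path_prob[where q = "transition I act f"])
  show "prob_space Q" "\<And>n. Z n \<in> measurable Q (count_space (UNIV \<times> ncliques I))"
    "\<And>s. s \<in> UNIV \<times> ncliques I \<Longrightarrow> measure Q {\<omega> \<in> space Q. Z 0 \<omega> = s} = initial_law I f \<alpha> s"
    using assms(1) by (auto simp: markov_chain_def)
  fix n z
  assume "\<And>i. i \<le> Suc n \<Longrightarrow> z i \<in> UNIV \<times> ncliques I"
    and pos: "measure Q {\<omega> \<in> space Q. \<forall>i\<le>n. Z i \<omega> = z i} > 0"
  then have "\<P>(\<omega> in Q. Z (Suc n) \<omega> = z (Suc n) \<bar> \<forall>i\<le>n. Z i \<omega> = z i) = transition I act f (z n) (z (Suc n))"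
    using assms(1) unfolding markov_chain_def by blast
  moreover have "(Z (Suc n) \<omega> = z (Suc n) \<and> (\<forall>i\<le>n. Z i \<omega> = z i)) \<longleftrightarrow> (\<forall>i\<le>Suc n. Z i \<omega> = z i)" for \<omega>
    by (auto simp: le_Suc_eq)
  ultimately show "measure Q {\<omega> \<in> space Q. \<forall>i\<le>Suc n. Z i \<omega> = z i} =
      measure Q {\<omega> \<in> space Q. \<forall>i\<le>n. Z i \<omega> = z i} * transition I act f (z n) (z (Suc n))"
    using pos by (simp add: cond_prob_def field_simps)
qed (use assms(2) in auto)

lemma snd_measurable:
  assumes "Y \<in> measurable Q (count_space (UNIV \<times> C))"
  shows "(\<lambda>\<omega>. snd (Y \<omega>)) \<in> measurable Q (count_space C)"
  by (rule measurable_compose[OF assms]) auto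

section \<open>Existence of the boundary measures, as laws of suitable chains\<close>

lemma exists_bdry_measure:
  "\<exists>R. prob_space R \<and> sets R = sets (bdry_algebra I) \<and> (\<forall>x\<in>traces. measure R (cyl I x) = f \<alpha> x)"
proof -
  let ?S = "UNIV \<times> ncliques I :: ('x \<times> 'a trace) set"
  \<comment> \<open>The transition matrix has a zero row wherever \<open>g\<close> vanishes. The
    initial law is put there to obtain a stochastic kernel; \<open>path_prob\<close> admits this
    change.\<close>
  define q where "q s = (if g (act (fst s) (snd s)) (snd s) = 0 then initial_law I f (fst s)
      else transition I act f s)" for s :: "'x \<times> 'a trace"
  have init_nonneg: "initial_law I f \<beta> s \<ge> 0" if "s \<in> ?S" for \<beta> s
    using that by (auto simp: initial_law_def h_nonneg)
  have init_sum: "sum (initial_law I f \<beta>) ?S = 1" for \<beta>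
  proof -
    have "sum (initial_law I f \<beta>) ?S = (\<Sum>\<beta>'\<in>UNIV. \<Sum>c\<in>ncliques I. initial_law I f \<beta> (\<beta>', c))"
      by (simp add: sum.cartesian_product)
    also have "\<dots> = (\<Sum>\<beta>'\<in>UNIV. if \<beta>' = \<beta> then 1 else 0)"
      by (intro sum.cong) (auto simp: initial_law_def sum_h)
    finally show ?thesis by simp
  qed
  have q_sum: "sum (q s) ?S = 1" for s
  proof (cases "g (act (fst s) (snd s)) (snd s) = 0")
    case False
    let ?\<beta> = "act (fst s) (snd s)" and ?c = "snd s"
    have "sum (q s) ?S = (\<Sum>\<beta>'\<in>UNIV. \<Sum>c\<in>ncliques I. transition I act f s (\<beta>', c))"
      using False by (simp add: q_def sum.cartesian_product)
    also have "\<dots> = (\<Sum>\<beta>'\<in>UNIV. if \<beta>' = ?\<beta> then 1 else 0)"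
    proof (intro sum.cong HOL.refl)
      fix \<beta>'
      have "(\<Sum>c\<in>ncliques I. transition I act f s (\<beta>', c)) =
          (if \<beta>' = ?\<beta> then (\<Sum>c\<in>ncliques I. if clique_arrow I ?c c then h ?\<beta> c / g ?\<beta> ?c else 0) else 0)"
        using False by (auto simp: transition_def case_prod_unfold intro!: sum.cong sum.neutral)
      also have "(\<Sum>c\<in>ncliques I. if clique_arrow I ?c c then h ?\<beta> c / g ?\<beta> ?c else 0) =
          (\<Sum>c | c \<in> ncliques I \<and> clique_arrow I ?c c. h ?\<beta> c / g ?\<beta> ?c)"
        by (intro sum.mono_neutral_cong_right) auto
      also have "\<dots> = g ?\<beta> ?c / g ?\<beta> ?c" 
        unfolding g_fun_def by (rule sum_divide_distrib[symmetric])
      finally show "(\<Sum>c\<in>ncliques I. transition I act f s (\<beta>', c)) = (if \<beta>' = ?\<beta> then 1 else 0)"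
        using False by simp
    qed
    finally show ?thesis by simp
  qed (simp add: q_def init_sum)
  have q_nonneg: "q s t \<ge> 0" if "t \<in> ?S" for s t
    using that init_nonneg[of t] by (auto simp: q_def transition_def case_prod_unfold h_nonneg g_nonneg)
  obtain Q :: "(nat \<times> ('x \<times> 'a trace) \<Rightarrow> 'x \<times> 'a trace) measure" and Z
    where Q: "prob_space Q" and Z: "\<And>n. Z n \<in> measurable Q (count_space ?S)"
      and path: "\<And>n z. (\<And>i. i \<le> n \<Longrightarrow> z i \<in> ?S) \<Longrightarrow>
           measure Q {\<omega> \<in> space Q. \<forall>i\<le>n. Z i \<omega> = z i} =
           initial_law I f \<alpha> (z 0) * (\<Prod>i<n. q (z i) (z (Suc i)))"
    by (rule markov_chain_exists[of ?S "initial_law I f \<alpha>" q])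
      (use init_nonneg init_sum q_sum q_nonneg in auto)
  have law: "measure Q {\<omega> \<in> space Q. \<forall>i\<le>n. Z i \<omega> = z i} =
      (if consistent \<alpha> z n then weight \<alpha> (map (\<lambda>i. snd (z i)) [0..<Suc n]) else 0)"
    if "\<And>i. i \<le> n \<Longrightarrow> z i \<in> ?S" for n z
  proof (rule path_prob[OF Q Z, where q = q])
    show "measure Q {\<omega> \<in> space Q. Z 0 \<omega> = s} = initial_law I f \<alpha> s" if "s \<in> ?S" for s
      using path[of 0 "\<lambda>_. s"] that by simp
    show "measure Q {\<omega> \<in> space Q. \<forall>i\<le>Suc n. Z i \<omega> = z i} =
        measure Q {\<omega> \<in> space Q. \<forall>i\<le>n. Z i \<omega> = z i} * q (z n) (z (Suc n))"
      if "\<And>i. i \<le> Suc n \<Longrightarrow> z i \<in> ?S" for n z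
      using path[of "Suc n" z] path[of n z] that by simp
  qed (use that in \<open>auto simp: q_def\<close>)
  have "measure Q {\<omega> \<in> space Q. map (\<lambda>i. snd (Z i \<omega>)) [0..<length cs] = cs} =
      (if normal cs then weight \<alpha> cs else 0)" if "set cs \<subseteq> ncliques I" "cs \<noteq> []" for cs
    by (rule clique_path_prob[OF Q Z _ that]) (rule law)
  from law_on_bdry(2)[OF Q snd_measurable[OF Z] this] show ?thesis by blast
qed

end

section \<open>Existence, uniqueness and the law of an arbitrary chain\<close>

theorem theorem2:
  fixes I :: "('a::finite \<times> 'a) set"
    and act :: "'x::finite \<Rightarrow> 'a trace \<Rightarrow> 'x"
    and f :: "'x \<Rightarrow> 'a trace \<Rightarrow> real"
  assumes "CARD('a) \<ge> 2"
    and "irrefl I" and "sym I"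
    and "right_action I act"
    and "moebius_fibred_valuation I act f"
  shows "\<exists>P. (markov_measure I act P \<and>
              (\<forall>\<alpha>. \<forall>x\<in>carrier (trace_monoid I). f \<alpha> x = measure (P \<alpha>) (cyl I x))) \<and>
             (\<forall>P'. markov_measure I act P' \<and>
              (\<forall>\<alpha>. \<forall>x\<in>carrier (trace_monoid I). f \<alpha> x = measure (P' \<alpha>) (cyl I x)) \<longrightarrow> P' = P) \<and>
             (\<forall>\<alpha> (Q :: 'w measure) Z.
                markov_chain Q (UNIV \<times> ncliques I) (initial_law I f \<alpha>) (transition I act f) Z \<longrightarrow>
                (let \<xi> = (\<lambda>\<omega> i. snd (Z i \<omega>)) in
                   (AE \<omega> in Q. \<xi> \<omega> \<in> bdry I \<and> bdry_join I (partial_prod I (\<xi> \<omega>)) (\<xi> \<omega>)) \<and>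
                   (\<forall>A\<in>sets (bdry_algebra I).
                      \<xi> -` A \<inter> space Q \<in> sets Q \<and>
                      emeasure (P \<alpha>) A = emeasure Q (\<xi> -` A \<inter> space Q))))"
proof -
  interpret moebius_valuation I act f
    by unfold_locales (use assms in auto)
  obtain P where P: "\<And>\<alpha>. prob_space (P \<alpha>)" "\<And>\<alpha>. sets (P \<alpha>) = sets (bdry_algebra I)"
    "\<And>\<alpha> x. x \<in> traces \<Longrightarrow> measure (P \<alpha>) (cyl I x) = f \<alpha> x"
    using exists_bdry_measure by metis
  have unique: "R = P \<alpha>"
    if "prob_space R" "sets R = sets (bdry_algebra I)" "\<And>x. x \<in> traces \<Longrightarrow> measure R (cyl I x) = f \<alpha> x" for R \<alpha>
    using that P by (intro measure_eqI_cyl) (auto intro: prob_space.finite_measure)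
  have markov: "markov_measure I act P"
    unfolding markov_measure_def using P by (simp add: f_mult)
  have unique_family: "P' = P"
    if "markov_measure I act P'" "\<forall>\<alpha>. \<forall>x\<in>traces. f \<alpha> x = measure (P' \<alpha>) (cyl I x)" for P'
    using that by (intro ext unique) (auto simp: markov_measure_def)
  have chain_law: "let \<xi> = (\<lambda>\<omega> i. snd (Z i \<omega>)) in
      (AE \<omega> in Q. \<xi> \<omega> \<in> bdry I \<and> bdry_join I (partial_prod I (\<xi> \<omega>)) (\<xi> \<omega>)) \<and>
      (\<forall>A\<in>sets (bdry_algebra I).
         \<xi> -` A \<inter> space Q \<in> sets Q \<and> emeasure (P \<alpha>) A = emeasure Q (\<xi> -` A \<inter> space Q))"
    if chain: "markov_chain Q (UNIV \<times> ncliques I) (initial_law I f \<alpha>) (transition I act f) Z"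
    for \<alpha> and Q :: "'w measure" and Z
  proof -
    have Q: "prob_space Q" and Z: "\<And>n. Z n \<in> measurable Q (count_space (UNIV \<times> ncliques I))"
      using chain by (auto simp: markov_chain_def)
    have "measure Q {\<omega> \<in> space Q. map (\<lambda>i. snd (Z i \<omega>)) [0..<length cs] = cs} =
        (if normal cs then weight \<alpha> cs else 0)" if "set cs \<subseteq> ncliques I" "cs \<noteq> []" for cs
      by (rule clique_path_prob[OF Q Z _ that]) (rule markov_chain_path_prob[OF chain])
    note law = law_on_bdry[OF Q snd_measurable[OF Z] this]
    obtain R where R: "prob_space R" "sets R = sets (bdry_algebra I)"
      "\<And>x. x \<in> traces \<Longrightarrow> measure R (cyl I x) = f \<alpha> x"
      "\<And>A. A \<in> sets (bdry_algebra I) \<Longrightarrow> (\<lambda>\<omega> i. snd (Z i \<omega>)) -` A \<inter> space Q \<in> sets Q \<and>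
         emeasure R A = emeasure Q ((\<lambda>\<omega> i. snd (Z i \<omega>)) -` A \<inter> space Q)"
      using law(2) by blast
    \<comment> \<open>The law of the given chain has the same values on all \<open>cyl I x\<close>
      as the measure built from the auxiliary chain, so uniqueness identifies them.\<close>
    have "R = P \<alpha>" using R by (intro unique) auto
    moreover have "AE \<omega> in Q. (\<lambda>i. snd (Z i \<omega>)) \<in> bdry I \<and>
        bdry_join I (partial_prod I (\<lambda>i. snd (Z i \<omega>))) (\<lambda>i. snd (Z i \<omega>))"
      using law(1) by (rule AE_mp) (auto intro: bdry_join_partial_prod)
    ultimately show ?thesis
      unfolding Let_def using R(4) by blast
  qed
  show ?thesis
  proof (rule exI[of _ P], intro conjI allI impI)
    show "markov_measure I act P" by (rule markov)
    show "\<forall>x\<in>traces. f \<alpha> x = measure (P \<alpha>) (cyl I x)" for \<alpha> by (simp add: P(3))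
  qed (blast intro: unique_family, rule chain_law)
qed

end
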